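(* Let $q\ge 25$ be a prime power and let $\mathcal L$ be a set of planes of ${\rm PG}(5,q)$ such that $\mathcal L$ is non-empty and does not contain all planes of ${\rm PG}(5,q)$. Put $\lambda_2=q^3-q-1$. Suppose that there is an integer $x>0$ with $|\mathcal L|=x(q^2+1)(q^2-q+1)$ such that every plane of $\mathcal L$ meets exactly $\lambda_2+x$ other planes of $\mathcal L$ in a line and every plane not in $\mathcal L$ meets exactly $x$ planes of $\mathcal L$ in a line. Then $x\ge (q+1)^2$. Moreover, if $x=(q+1)^2$, then one of the following holds: (a) there is a solid $S$ of ${\rm PG}(5,q)$ such that every plane of $S$ belongs to $\mathcal L$ and every plane of $\mathcal L$ is contained in $S$ or meets $S$ in exactly one point; or, dually, there is a line $\ell$ such that all planes on $\ell$ belong to $\mathcal L$ and every plane of $\mathcal L$ contains $\ell$ or is skew to $\ell$; (b) every line and every solid of ${\rm PG}(5,q)$ is incident with either $0$ or $q+1$ planes of $\mathcal L$.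
   Context: A plane is a 2-dimensional and a solid a 3-dimensional projective subspace of ${\rm PG}(5,q)$. A line and a plane are incident if the line lies in the plane; a solid and a plane are incident if the plane lies in the solid. *)

theory Defs
  imports "HOL-Analysis.Cartesian_Space" "HOL-Number_Theory.Prime_Powers"
begin

text \<open>
  Projective subspaces are represented by linear subspaces of a coordinate space over a field,
  ordered by inclusion. A projective subspace of projective dimension \<open>d\<close> is a linear subspace
  of vector space dimension \<open>d + 1\<close>. In particular \<open>PG(5,q)\<close> is the geometry of subspaces
  of \<open>'a^6\<close>, where \<open>'a\<close> is a field with \<open>q\<close> elements. Incidence is inclusion, and the
  intersection of two projective subspaces is the intersection of the linear subspaces; the
  empty projective subspace is \<open>{0}\<close>.
\<close>

definition proj_subspace :: "nat \<Rightarrow> ('a::field ^ 'n) set \<Rightarrow> bool" where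
  "proj_subspace d U \<longleftrightarrow> vec.subspace U \<and> vec.dim U = d + 1"

abbreviation is_point :: "('a::field ^ 'n) set \<Rightarrow> bool" where
  "is_point \<equiv> proj_subspace 0"

abbreviation is_line :: "('a::field ^ 'n) set \<Rightarrow> bool" where
  "is_line \<equiv> proj_subspace 1"

abbreviation is_plane :: "('a::field ^ 'n) set \<Rightarrow> bool" where
  "is_plane \<equiv> proj_subspace 2"

abbreviation is_solid :: "('a::field ^ 'n) set \<Rightarrow> bool" where
  "is_solid \<equiv> proj_subspace 3"

definition skew :: "('a::field ^ 'n) set \<Rightarrow> ('a ^ 'n) set \<Rightarrow> bool" where
  "skew U W \<longleftrightarrow> U \<inter> W = {0}"

text \<open>Integer-valued, so that the subtraction is not truncated.\<close>

definition lambda2 :: "nat \<Rightarrow> int" where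
  "lambda2 q = int q ^ 3 - int q - 1"

end

theory Submission
  imports Defs
begin

text \<open>
  For a line \<open>l\<close>, the planes and solids on \<open>l\<close> are the points and lines of a PG(3,q). Let \<open>T\<close> be the
  set of its points that come from \<open>L\<close>, \<open>n = |T|\<close>, and give each line \<open>S\<close> the weight \<open>w S\<close>, the
  number of planes of \<open>L\<close> in \<open>S\<close> not on \<open>l\<close>. The regularity of \<open>L\<close> says exactly that the weights of
  the lines through a point sum to \<open>x - n\<close>, plus \<open>q\<^sup>3 - q\<close> if the point lies in \<open>T\<close>. Double counting
  gives the sums of \<open>w\<close> and of \<open>w \<cdot> k\<close>, where \<open>k S = |S \<inter> T|\<close>; for \<open>x \<le> (q + 1)\<^sup>2\<close> the weighted mean of
  \<open>k\<close> is at least \<open>n / (q + 1)\<close>, so the second moment \<open>\<Sum> w k (k - 1)\<close> is large. It cannot be, since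
  \<open>\<Sum> k (k - 1) = n (n - 1)\<close> and the weights are bounded: by \<open>n - k\<close>, if \<open>n\<close> is the largest number of
  planes of \<open>L\<close> on any line or, dually, in any solid, and by \<open>x - n\<close>, if \<open>S\<close> is not contained in
  \<open>T\<close>; few lines are contained in \<open>T\<close>, since a plane has at most \<open>2 q + 2\<close> points in \<open>T\<close>.
  Hence \<open>n \<le> q + 1\<close> unless \<open>L\<close> contains all planes on some line or in some solid, and averaging over
  the lines of a plane of \<open>L\<close> finishes the proof. Duality is available because the subspaces are
  treated as an abstract lattice with self-dual axioms.
\<close>

section \<open>Weighted lines of a projective 3-space\<close>

lemma sum_swap_card:
  fixes w :: "'b \<Rightarrow> int"
  assumes "finite A" "finite B"
  shows "(\<Sum>a\<in>A. \<Sum>b\<in>{b\<in>B. R a b}. w b) = (\<Sum>b\<in>B. w b * int (card {a\<in>A. R a b}))"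
proof -
  have "(\<Sum>a\<in>A. \<Sum>b\<in>{b\<in>B. R a b}. w b) = (\<Sum>b\<in>B. \<Sum>a\<in>{a\<in>A. R a b}. w b)"
    by (rule sum.swap_restrict) (use assms in auto)
  then show ?thesis by (simp add: mult.commute)
qed

lemma sum_card_swap:
  assumes "finite A" "finite B"
  shows "(\<Sum>a\<in>A. int (card {b\<in>B. R a b})) = (\<Sum>b\<in>B. int (card {a\<in>A. R a b}))"
  using sum_swap_card[OF assms, where R = R and w = "\<lambda>_. 1"] by simp

text \<open>PG(3,q) enters through its point and line counts alone, and \<open>T\<close> is an
  arbitrary set of points. The bound on \<open>q\<close> is the one under which the last polynomial
  in \<open>not_upper_range\<close> is visibly positive.\<close>

locale linear_space =
  fixes q :: int and Pt T :: "'p set" and Ln :: "'l set" and inc :: "'p \<Rightarrow> 'l \<Rightarrow> bool"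
  assumes q_ge: "q \<ge> 9"
    and fin_Pt: "finite Pt" and fin_Ln: "finite Ln" and T_sub: "T \<subseteq> Pt"
    and card_Pt: "int (card Pt) = (q + 1) * (q^2 + 1)"
    and join: "\<lbrakk>p \<in> Pt; p' \<in> Pt; p \<noteq> p'\<rbrakk> \<Longrightarrow> card {S\<in>Ln. inc p S \<and> inc p' S} = 1"
    and card_line: "S \<in> Ln \<Longrightarrow> int (card {p\<in>Pt. inc p S}) = q + 1"
    and card_pencil: "p \<in> Pt \<Longrightarrow> int (card {S\<in>Ln. inc p S}) = q^2 + q + 1"
begin

definition n :: int where "n = int (card T)"

definition k :: "'l \<Rightarrow> int" where "k S = int (card {p\<in>T. inc p S})"

lemma fin_T: "finite T"
  using T_sub fin_Pt finite_subset by blast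

lemma n_nonneg: "n \<ge> 0" by (simp add: n_def)

lemma k_nonneg: "k S \<ge> 0" by (simp add: k_def)

lemma k_le: "S \<in> Ln \<Longrightarrow> k S \<le> q + 1"
  unfolding k_def card_line[symmetric] using T_sub fin_Pt
  by (intro iffD2[OF of_nat_le_iff] card_mono) auto

text \<open>A point of \<open>T\<close> other than \<open>p\<close> is on exactly one line through
  \<open>p\<close>, whereas \<open>p\<close> itself is on all \<open>q^2 + q + 1\<close> of
  them.\<close>

lemma sum_k_pencil:
  assumes "p \<in> Pt"
  shows "(\<Sum>S\<in>{S\<in>Ln. inc p S}. k S) = n + (if p \<in> T then q^2 + q else 0)"
proof -
  have "(\<Sum>S\<in>{S\<in>Ln. inc p S}. k S) = (\<Sum>p'\<in>T. int (card {S\<in>{S\<in>Ln. inc p S}. inc p' S}))"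
    unfolding k_def by (rule sum_card_swap) (auto simp: fin_T fin_Ln)
  also have "\<dots> = (\<Sum>p'\<in>T. 1 + (if p' = p then q^2 + q else 0))"
  proof (rule sum.cong[OF refl])
    fix p' assume p': "p' \<in> T"
    show "int (card {S\<in>{S\<in>Ln. inc p S}. inc p' S}) = 1 + (if p' = p then q^2 + q else 0)"
    proof (cases "p' = p")
      case True
      then have "{S\<in>{S\<in>Ln. inc p S}. inc p' S} = {S\<in>Ln. inc p S}" by auto
      then show ?thesis using True card_pencil[OF assms] by simp
    next
      case False
      have "{S\<in>{S\<in>Ln. inc p S}. inc p' S} = {S\<in>Ln. inc p S \<and> inc p' S}" by auto
      then show ?thesis using False join[OF assms, of p'] p' T_sub by auto
    qed
  qed
  also have "\<dots> = n + (if p \<in> T then q^2 + q else 0)"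
    using fin_T by (simp add: sum.distrib n_def)
  finally show ?thesis .
qed

lemma sum_k_times:
  "(\<Sum>S\<in>Ln. g S * k S) = (\<Sum>p\<in>T. \<Sum>S\<in>{S\<in>Ln. inc p S}. g S)"
  unfolding k_def by (rule sum_swap_card[symmetric]) (auto simp: fin_T fin_Ln)

lemma sum_k: "(\<Sum>S\<in>Ln. k S) = n * (q^2 + q + 1)"
proof -
  have "(\<Sum>S\<in>Ln. k S) = (\<Sum>p\<in>T. int (card {S\<in>Ln. inc p S}))"
    using sum_k_times[of "\<lambda>_. 1"] by simp
  also have "\<dots> = (\<Sum>p\<in>T. q^2 + q + 1)"
    by (rule sum.cong) (use T_sub card_pencil in auto)
  finally show ?thesis by (simp add: n_def algebra_simps)
qed

text \<open>Both sides count ordered pairs of distinct points of \<open>T\<close>, each pair being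
  on exactly one line. The sum of squares comes from adding \<open>sum_k_pencil\<close> over the
  points of \<open>T\<close>.\<close>

lemma sum_pairs: "(\<Sum>S\<in>Ln. k S * (k S - 1)) = n * (n - 1)"
proof -
  have "(\<Sum>S\<in>Ln. k S * k S) = (\<Sum>p\<in>T. n + (q^2 + q))"
    unfolding sum_k_times by (rule sum.cong) (use T_sub sum_k_pencil in auto)
  then have "(\<Sum>S\<in>Ln. k S * k S) = n * (n + (q^2 + q))"
    by (simp add: n_def algebra_simps)
  then show ?thesis using sum_k by (simp add: algebra_simps sum_subtractf)
qed

end

locale weighted_linear_space = linear_space q Pt T Ln inc
  for q :: int and Pt T :: "'p set" and Ln :: "'l set" and inc +
  fixes x :: int and w :: "'l \<Rightarrow> int"
  assumes w_nonneg: "S \<in> Ln \<Longrightarrow> w S \<ge> 0"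
    and w_pencil: "p \<in> Pt \<Longrightarrow>
      (\<Sum>S\<in>{S\<in>Ln. inc p S}. w S) = x - n + (if p \<in> T then q^3 - q else 0)"
begin

text \<open>Adding \<open>w_pencil\<close> over all points counts every line \<open>q + 1\<close>
  times.\<close>

lemma sum_w: "(\<Sum>S\<in>Ln. w S) = x * (q^2 + 1) - (q + 1) * n"
proof -
  have "(\<Sum>p\<in>Pt. \<Sum>S\<in>{S\<in>Ln. inc p S}. w S) = (\<Sum>S\<in>Ln. w S * int (card {p\<in>Pt. inc p S}))"
    by (rule sum_swap_card) (auto simp: fin_Pt fin_Ln)
  also have "\<dots> = (\<Sum>S\<in>Ln. w S * (q + 1))"
    by (rule sum.cong) (use card_line in auto)
  also have "\<dots> = (q + 1) * (\<Sum>S\<in>Ln. w S)"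
    by (simp add: sum_distrib_left mult.commute)
  also have "(\<Sum>p\<in>Pt. \<Sum>S\<in>{S\<in>Ln. inc p S}. w S) =
      (\<Sum>p\<in>Pt. (x - n) + (if p \<in> T then q^3 - q else 0))"
    by (rule sum.cong) (use w_pencil in \<open>auto simp: n_def\<close>)
  also have "\<dots> = int (card Pt) * (x - n) + (\<Sum>p\<in>Pt. if p \<in> T then q^3 - q else 0)"
    by (simp add: sum.distrib)
  also have "(\<Sum>p\<in>Pt. if p \<in> T then q^3 - q else 0) = n * (q^3 - q)"
    using T_sub fin_Pt by (simp add: sum.If_cases n_def Int_absorb1 Collect_mem_eq)
  finally have "(q + 1) * (\<Sum>S\<in>Ln. w S) = (q + 1) * (q^2 + 1) * (x - n) + n * (q^3 - q)"
    using card_Pt by simp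
  also have "\<dots> = (q + 1) * (x * (q^2 + 1) - (q + 1) * n)"
    by algebra
  finally show ?thesis using q_ge by simp
qed

lemma sum_w_k: "(\<Sum>S\<in>Ln. w S * k S) = n * (x - n + q^3 - q)"
proof -
  have "(\<Sum>S\<in>Ln. w S * k S) = (\<Sum>p\<in>T. x - n + q^3 - q)"
    unfolding sum_k_times by (rule sum.cong) (use T_sub w_pencil in \<open>auto simp: n_def\<close>)
  then show ?thesis by (simp add: n_def algebra_simps)
qed

section \<open>Lower bounds for the second moment of \<open>k\<close> under the weights
  \<open>w\<close>\<close>

definition W :: int where "W = (\<Sum>S\<in>Ln. w S * (k S * (k S - 1)))"

text \<open>By \<open>card_Pt\<close>, this is the number of points off \<open>T\<close>.\<close>

definition G :: int where "G = (q + 1) * (q^2 + 1) - n"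

text \<open>Chebyshev-type estimate around the value \<open>k S = n / (q + 1)\<close>, which is the
  \<open>w\<close>-weighted mean of \<open>k\<close> when \<open>x = (q + 1)\<^sup>2\<close>.\<close>

lemma weighted_pairs_ge:
  assumes "x \<le> (q + 1)^2"
  shows "n * (G * (n - q - 1)) \<le> (q + 1) * W"
proof -
  define A where "A = (\<Sum>S\<in>Ln. w S * k S)"
  define Z where "Z = (\<Sum>S\<in>Ln. w S)"
  \<comment> \<open>The deviation is scaled by \<open>q + 1\<close> to stay in the integers.
    Expanding in \<open>k S * (k S - 1)\<close>, \<open>k S\<close> and 1 produces the three sums
    \<open>W\<close>, \<open>A\<close> and \<open>Z\<close>.\<close>
  have "0 \<le> (\<Sum>S\<in>Ln. w S * ((q + 1) * k S - n)^2)"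
    by (intro sum_nonneg mult_nonneg_nonneg w_nonneg) auto
  also have "\<dots> = (\<Sum>S\<in>Ln. (q + 1)^2 * (w S * (k S * (k S - 1)))
      + ((q + 1)^2 - 2 * n * (q + 1)) * (w S * k S) + n^2 * w S)"
    by (rule sum.cong) (auto simp: algebra_simps power2_eq_square)
  also have "\<dots> = (q + 1)^2 * W + ((q + 1)^2 - 2 * n * (q + 1)) * A + n^2 * Z"
    by (simp add: sum.distrib W_def A_def Z_def flip: sum_distrib_left)
  finally have 1: "0 \<le> (q + 1)^2 * W + ((q + 1)^2 - 2 * n * (q + 1)) * A + n^2 * Z" .
  \<comment> \<open>Isolates the terms that vanish for \<open>x = (q + 1)^2\<close>. They have the
    favourable sign because \<open>q^2 - 2 * q - 1\<close> is not negative.\<close>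
  define y where "y = (q + 1)^2 - x"
  have x: "x = (q + 1)^2 - y" by (simp add: y_def)
  have y: "y \<ge> 0" using assms by (simp add: y_def)
  have "((q + 1)^2 - 2 * n * (q + 1)) * A + n^2 * Z =
      - ((q + 1) * (n * (G * (n - q - 1)))) - n * y * (n * (q^2 - 2 * q - 1) + (q + 1)^2)"
    unfolding A_def Z_def sum_w sum_w_k G_def x by algebra
  moreover have "0 \<le> n * y * (n * (q^2 - 2 * q - 1) + (q + 1)^2)"
  proof -
    have "q * 9 \<le> q * q" using q_ge by (intro mult_left_mono) auto
    then have "0 \<le> q^2 - 2 * q - 1" using q_ge by (simp add: power2_eq_square)
    then show ?thesis using n_nonneg y by simp
  qed
  ultimately have "(q + 1) * (n * (G * (n - q - 1))) \<le> (q + 1)^2 * W" using 1 by linarith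
  then have "(q + 1) * (n * (G * (n - q - 1))) \<le> (q + 1) * ((q + 1) * W)"
    by (simp add: power2_eq_square mult.assoc)
  then show ?thesis using q_ge by simp
qed

text \<open>Uses that \<open>(k - 1) * (k - 2)\<close> is never negative at an integer. This is
  meant for \<open>n = q + 2\<close>, where the weighted mean of \<open>k\<close> is close to 1:
  there it gains a factor of almost 2 over \<open>weighted_pairs_ge\<close>, which would be too
  weak.\<close>

lemma weighted_pairs_ge':
  assumes "x \<le> (q + 1)^2" "n \<le> q^2 + 1"
  shows "2 * (n - q - 1) * G \<le> W"
proof -
  have "0 \<le> (\<Sum>S\<in>Ln. w S * ((k S - 1) * (k S - 2)))"
  proof (rule sum_nonneg)
    fix S assume "S \<in> Ln"
    moreover have "0 \<le> (k S - 1) * (k S - 2)"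
      by (cases "k S \<le> 1") (auto intro: mult_nonneg_nonneg mult_nonpos_nonpos)
    ultimately show "0 \<le> w S * ((k S - 1) * (k S - 2))" using w_nonneg by simp
  qed
  also have "\<dots> = (\<Sum>S\<in>Ln. w S * (k S * (k S - 1)) - 2 * (w S * k S) + 2 * w S)"
    by (rule sum.cong) (auto simp: algebra_simps)
  also have "\<dots> = W - 2 * (n * (x - n + q^3 - q)) + 2 * (x * (q^2 + 1) - (q + 1) * n)"
    by (simp add: sum.distrib sum_subtractf W_def flip: sum_distrib_left sum_w sum_w_k)
  finally have 1: "0 \<le> W - 2 * (n * (x - n + q^3 - q)) + 2 * (x * (q^2 + 1) - (q + 1) * n)" .
  have "2 * (n * (x - n + q^3 - q)) - 2 * (x * (q^2 + 1) - (q + 1) * n) =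
     2 * (n - q - 1) * G + 2 * (((q + 1)^2 - x) * (q^2 + 1 - n))"
    unfolding G_def by algebra
  moreover have "0 \<le> ((q + 1)^2 - x) * (q^2 + 1 - n)"
    using assms by simp
  ultimately show ?thesis using 1 by linarith
qed

text \<open>\<open>S\<close> has a point off \<open>T\<close>, and all lines through that point
  together weigh \<open>x - n\<close>.\<close>

lemma w_le_of_missing_point:
  assumes "S \<in> Ln" "k S < q + 1"
  shows "w S \<le> x - n"
proof -
  obtain p where p: "p \<in> Pt" "inc p S" "p \<notin> T"
  proof -
    have "\<not> {p\<in>Pt. inc p S} \<subseteq> {p\<in>T. inc p S}"
    proof
      assume "{p\<in>Pt. inc p S} \<subseteq> {p\<in>T. inc p S}"
      then have "card {p\<in>Pt. inc p S} \<le> card {p\<in>T. inc p S}"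
        by (intro card_mono) (auto simp: fin_T)
      then show False using card_line[OF assms(1)] assms(2) by (simp add: k_def)
    qed
    then show ?thesis using that by auto
  qed
  have "w S \<le> (\<Sum>S\<in>{S\<in>Ln. inc p S}. w S)"
    by (rule member_le_sum) (use assms p fin_Ln w_nonneg in auto)
  then show ?thesis using w_pencil[OF p(1)] p(3) by (simp add: n_def)
qed

text \<open>With at most \<open>q\<close> points in \<open>T\<close>, every line has a point off
  \<open>T\<close>, so \<open>n = x\<close> makes all weights zero. The lines through a point of
  \<open>T\<close> would then sum to 0 instead of \<open>q^3 - q\<close>.\<close>

lemma n_small_ne_x:
  assumes "0 < n" "n \<le> q"
  shows "n \<noteq> x"
proof
  assume "n = x"
  have "w S = 0" if "S \<in> Ln" for S
  proof -
    have "k S \<le> n" unfolding k_def n_def by (auto intro!: card_mono simp: fin_T)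
    then show ?thesis
      using w_le_of_missing_point[OF that] w_nonneg[OF that] assms \<open>n = x\<close> by simp
  qed
  moreover obtain p where p: "p \<in> T" using assms(1) by (auto simp: n_def card_gt_0_iff)
  ultimately have "x - n + (q^3 - q) = 0"
    using w_pencil[of p] T_sub by (auto simp: n_def)
  then have "q * (q * q - 1) = 0" using \<open>n = x\<close> by (simp add: algebra_simps power3_eq_cube)
  then show False using q_ge by (auto simp: zmult_eq_1_iff)
qed

text \<open>A line with \<open>k\<close> at least 2 weighs at most \<open>n - 2\<close>, so
  \<open>sum_pairs\<close> gives \<open>W\<close> at most \<open>(n - 2) * (n * (n - 1))\<close>. In
  the middle range this falls short of the lower bounds for \<open>W\<close>.\<close>

lemma not_mid_range:
  assumes x: "x \<le> (q + 1)^2" and max: "\<And>S. S \<in> Ln \<Longrightarrow> w S + k S \<le> n"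
  shows "n \<le> q + 1 \<or> n > q^2 - 2 * q"
proof (rule ccontr)
  assume "\<not> ?thesis"
  then have n: "q + 2 \<le> n" "n \<le> q^2 - 2 * q" by auto
  have qq: "9 * q \<le> q^2" using q_ge by (simp add: power2_eq_square)
  have "W \<le> (\<Sum>S\<in>Ln. (n - 2) * (k S * (k S - 1)))"
    unfolding W_def
  proof (rule sum_mono)
    fix S assume S: "S \<in> Ln"
    show "w S * (k S * (k S - 1)) \<le> (n - 2) * (k S * (k S - 1))"
    proof (cases "k S \<le> 1")
      case True
      then have "k S = 0 \<or> k S = 1" using k_nonneg[of S] by auto
      then show ?thesis by auto
    next
      case False
      then show ?thesis using max[OF S] by (intro mult_right_mono) auto
    qed
  qed
  then have W: "W \<le> (n - 2) * (n * (n - 1))"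
    by (simp add: sum_pairs flip: sum_distrib_left)
  show False
  proof (cases "n = q + 2")
    case True
    have "2 * (n - q - 1) * G \<le> (n - 2) * (n * (n - 1))"
      using weighted_pairs_ge'[OF x] n W q_ge by simp
    then have "2 * (q^3 + q^2 - 1) \<le> q * ((q + 2) * (q + 1))"
      unfolding G_def True by (simp add: algebra_simps power2_eq_square power3_eq_cube)
    moreover have "2 * (q^3 + q^2 - 1) - q * ((q + 2) * (q + 1)) = q^2 * (q - 1) - 2 * q - 2"
      by algebra
    moreover have "9 * q * 1 \<le> q^2 * (q - 1)" using q_ge qq by (intro mult_mono) auto
    ultimately show False using q_ge by simp
  next
    case False
    have "n * (G * (n - q - 1)) \<le> (q + 1) * ((n - 2) * (n * (n - 1)))"
      using weighted_pairs_ge[OF x] mult_left_mono[OF W, of "q + 1"] q_ge by linarith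
    then have "n * (G * (n - q - 1)) \<le> n * ((q + 1) * ((n - 2) * (n - 1)))"
      by (simp add: algebra_simps)
    then have "G * (n - q - 1) \<le> (q + 1) * ((n - 2) * (n - 1))"
      using n q_ge by simp
    moreover have "0 < G * (n - q - 1) - (q + 1) * ((n - 2) * (n - 1))"
    proof -
      \<comment> \<open>Distances of \<open>n\<close> from the ends \<open>q + 3\<close> and
        \<open>q^2 - 2 * q\<close> of the remaining range. The values of the difference at these
        ends are \<open>e1\<close> and \<open>e2\<close>.\<close>
      define a where "a = n - (q + 3)"
      define b where "b = q^2 - 2 * q - n"
      have a: "a \<ge> 0" and b: "b \<ge> 0" using n False by (auto simp: a_def b_def)
      text \<open>The difference is a concave quadratic in \<open>n\<close>: it is an interpolation of its values
        at the two ends plus a positive multiple of \<open>a * b\<close>.\<close>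
      define e1 where "e1 = q^3 - 2 * q^2 - 5 * q - 6"
      define e2 where "e2 = 5 * q^3 - 15 * q^2 - 14 * q - 3"
      have cube: "9 * q^2 \<le> q^3"
        using mult_right_mono[OF q_ge, of "q^2"] by (simp add: power3_eq_cube power2_eq_square)
      have len: "a + b = q^2 - 3 * q - 3" by (simp add: a_def b_def)
      have "(a + b) * (G * (n - q - 1) - (q + 1) * ((n - 2) * (n - 1))) =
          b * e1 + a * e2 + (a + b) * ((q + 2) * (a * b))"
        unfolding G_def a_def b_def e1_def e2_def by algebra
      moreover have "e1 > 0"
        using cube qq q_ge by (simp add: e1_def)
      moreover have "e2 > 0"
        using cube qq q_ge by (simp add: e2_def)
      moreover have "a + b > 0" using len qq q_ge by linarith
      moreover have "b * e1 + a * e2 > 0"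
        using \<open>e1 > 0\<close> \<open>e2 > 0\<close> \<open>a + b > 0\<close> a b
        by (cases "a = 0") (auto intro: add_nonneg_pos)
      moreover have "(a + b) * ((q + 2) * (a * b)) \<ge> 0" using a b q_ge by simp
      ultimately have "(a + b) * (G * (n - q - 1) - (q + 1) * ((n - 2) * (n - 1))) > 0"
        by linarith
      then show ?thesis using \<open>a + b > 0\<close> by (simp add: zero_less_mult_iff)
    qed
    ultimately show False by linarith
  qed
qed

section \<open>Lines contained in \<open>T\<close>, and the upper range of \<open>n\<close>\<close>

definition full_lines :: "'l set" where "full_lines = {S\<in>Ln. k S = q + 1}"

lemma fin_full: "finite full_lines" by (simp add: full_lines_def fin_Ln)

text \<open>Let \<open>z p\<close> be the number of full lines through \<open>p\<close>. Incidences
  give the sum of \<open>z\<close>, and the hypothesis on meeting lines bounds the sum of its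
  squares; together they limit the number of full lines.\<close>

lemma card_full_lines_le:
  assumes meet: "\<And>S. S \<in> full_lines \<Longrightarrow>
    int (card {S'\<in>full_lines. S' \<noteq> S \<and> (\<exists>p\<in>T. inc p S \<and> inc p S')}) \<le> q + 1"
  shows "(q + 1) * int (card full_lines) \<le> 2 * n"
proof -
  define z where "z p = int (card {S\<in>full_lines. inc p S})" for p
  let ?N = "int (card full_lines)"
  have kz: "(\<Sum>S\<in>full_lines. \<Sum>p\<in>{p\<in>T. inc p S}. g p) = (\<Sum>p\<in>T. g p * z p)" for g
    unfolding z_def by (rule sum_swap_card) (auto simp: fin_full fin_T)
  have sz: "(\<Sum>p\<in>T. z p) = ?N * (q + 1)"
  proof -
    have "(\<Sum>p\<in>T. z p) = (\<Sum>S\<in>full_lines. k S)"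
      using kz[of "\<lambda>_. 1"] by (simp add: k_def)
    also have "\<dots> = (\<Sum>S\<in>full_lines. q + 1)" by (rule sum.cong) (auto simp: full_lines_def)
    finally show ?thesis by simp
  qed
  have row: "(\<Sum>p\<in>{p\<in>T. inc p S}. z p) \<le> 2 * (q + 1)" if S: "S \<in> full_lines" for S
  proof -
    have SL: "S \<in> Ln" using S by (simp add: full_lines_def)
    \<comment> \<open>Every full line is counted by the points it shares with \<open>S\<close>:
      \<open>q + 1\<close> for \<open>S\<close> itself, at most one for any other.\<close>
    have "(\<Sum>p\<in>{p\<in>T. inc p S}. z p) =
        (\<Sum>S'\<in>full_lines. int (card {p\<in>{p\<in>T. inc p S}. inc p S'}))"
      unfolding z_def by (rule sum_card_swap) (auto simp: fin_full fin_T)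
    also have "\<dots> \<le> (\<Sum>S'\<in>full_lines. (if S' = S then q + 1 else 0) +
        (if S' \<noteq> S \<and> (\<exists>p\<in>T. inc p S \<and> inc p S') then 1 else 0))"
    proof (rule sum_mono)
      fix S' assume S': "S' \<in> full_lines"
      let ?A = "{p\<in>{p\<in>T. inc p S}. inc p S'}"
      show "int (card ?A) \<le> (if S' = S then q + 1 else 0) +
        (if S' \<noteq> S \<and> (\<exists>p\<in>T. inc p S \<and> inc p S') then 1 else 0)"
      proof (cases "S' = S")
        case True
        have "?A = {p\<in>T. inc p S}" using True by auto
        then show ?thesis using True k_le[OF SL] by (simp add: k_def)
      next
        case False
        have "finite ?A" using fin_T by simp
        have "card ?A \<le> Suc 0"
        proof (rule ccontr)
          assume "\<not> card ?A \<le> Suc 0"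
          then obtain p p' where pp: "p \<in> ?A" "p' \<in> ?A" "p \<noteq> p'"
            unfolding card_le_Suc0_iff_eq[OF \<open>finite ?A\<close>] by blast
          then have "card {S\<in>Ln. inc p S \<and> inc p' S} = 1" using join T_sub by auto
          then obtain l where l: "{S\<in>Ln. inc p S \<and> inc p' S} = {l}" by (rule card_1_singletonE)
          have "S \<in> {l}" "S' \<in> {l}"
            unfolding l[symmetric] using pp S S' by (auto simp: full_lines_def)
          then show False using False by simp
        qed
        moreover have "card ?A = 0" if "\<not> (\<exists>p\<in>T. inc p S \<and> inc p S')"
          using that \<open>finite ?A\<close> by auto
        ultimately show ?thesis using False by auto
      qed
    qed
    also have "\<dots> = (q + 1) +
        int (card {S'\<in>full_lines. S' \<noteq> S \<and> (\<exists>p\<in>T. inc p S \<and> inc p S')})"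
      using S fin_full by (simp add: sum.distrib sum.If_cases Int_def)
    finally show ?thesis using meet[OF S] by simp
  qed
  \<comment> \<open>No integer lies strictly between 2 and 3. Summed, \<open>5 * z p\<close> is at
    most \<open>z p * z p + 6\<close>, which turns the two moments into a linear bound.\<close>
  have "0 \<le> (\<Sum>p\<in>T. (z p - 2) * (z p - 3))"
  proof (rule sum_nonneg)
    fix p
    show "0 \<le> (z p - 2) * (z p - 3)"
      by (cases "z p \<le> 2") (auto intro: mult_nonneg_nonneg mult_nonpos_nonpos)
  qed
  also have "\<dots> = (\<Sum>p\<in>T. z p * z p - 5 * z p + 6)"
    by (rule sum.cong) (auto simp: algebra_simps)
  also have "\<dots> = (\<Sum>p\<in>T. z p * z p) - 5 * (?N * (q + 1)) + 6 * n"
    by (simp add: sum.distrib sum_subtractf n_def flip: sum_distrib_left sz)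
  also have "(\<Sum>p\<in>T. z p * z p) \<le> ?N * (2 * (q + 1))"
    unfolding kz[symmetric] using sum_mono[of full_lines _ "\<lambda>_. 2 * (q + 1)", OF row] by simp
  finally show ?thesis by (simp add: algebra_simps)
qed

text \<open>For \<open>n\<close> near \<open>(q + 1)^2\<close>, lines that are not full weigh at
  most the small number \<open>B\<close>. Full lines may weigh up to \<open>n - q - 1\<close>, but
  there are few of them, so \<open>W\<close> stays below \<open>weighted_pairs_ge\<close>.\<close>

lemma not_upper_range:
  assumes x: "x \<le> (q + 1)^2" and nx: "n \<le> x"
    and max: "\<And>S. S \<in> Ln \<Longrightarrow> w S + k S \<le> n"
    and meet: "\<And>S. S \<in> full_lines \<Longrightarrow>
      int (card {S'\<in>full_lines. S' \<noteq> S \<and> (\<exists>p\<in>T. inc p S \<and> inc p S')}) \<le> q + 1"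
  shows "n \<le> q^2 - 2 * q"
proof (rule ccontr)
  assume "\<not> ?thesis"
  then have n: "q^2 - 2 * q + 1 \<le> n" by simp
  have qq: "9 * q \<le> q^2" using q_ge by (simp add: power2_eq_square)
  define B where "B = (q + 1)^2 - n"
  let ?N = "int (card full_lines)"
  have B: "B \<ge> 0" using x nx by (simp add: B_def)
  have W: "W \<le> (\<Sum>S\<in>Ln. B * (k S * (k S - 1)) +
      (if S \<in> full_lines then (n - q - 1) * ((q + 1) * q) else 0))"
    unfolding W_def
  proof (rule sum_mono)
    fix S assume S: "S \<in> Ln"
    have nn: "0 \<le> k S * (k S - 1)"
      using k_nonneg[of S] by (cases "k S = 0") auto
    show "w S * (k S * (k S - 1)) \<le> B * (k S * (k S - 1)) +
      (if S \<in> full_lines then (n - q - 1) * ((q + 1) * q) else 0)"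
    proof (cases "S \<in> full_lines")
      case True
      then have "k S = q + 1" by (simp add: full_lines_def)
      then have "w S * (k S * (k S - 1)) \<le> (n - q - 1) * ((q + 1) * q)"
        using max[OF S] q_ge by (simp add: mult_right_mono)
      moreover have "0 \<le> B * (k S * (k S - 1))" using B nn by simp
      ultimately show ?thesis using True by simp
    next
      case False
      then have "k S < q + 1" using k_le[OF S] S by (auto simp: full_lines_def)
      then have "w S \<le> B" using w_le_of_missing_point[OF S] x by (simp add: B_def)
      then show ?thesis using False nn by (simp add: mult_right_mono)
    qed
  qed
  have "\<dots> = B * (n * (n - 1)) + ?N * ((n - q - 1) * ((q + 1) * q))"
  proof -
    have "Ln \<inter> full_lines = full_lines" by (auto simp: full_lines_def)
    then show ?thesis
      by (simp add: sum.distrib sum.If_cases fin_Ln sum_pairs flip: sum_distrib_left)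
  qed
  also have "?N * ((n - q - 1) * ((q + 1) * q)) = ((q + 1) * ?N) * ((n - q - 1) * q)"
    by (simp add: algebra_simps)
  also have "\<dots> \<le> (2 * n) * ((n - q - 1) * q)"
    using card_full_lines_le[OF meet] n qq q_ge by (intro mult_right_mono) auto
  finally have "W \<le> B * (n * (n - 1)) + (2 * n) * ((n - q - 1) * q)" using W by simp
  then have "n * (G * (n - q - 1)) \<le> (q + 1) * (B * (n * (n - 1)) + (2 * n) * ((n - q - 1) * q))"
    using weighted_pairs_ge[OF x] q_ge
      mult_left_mono[of W "B * (n * (n - 1)) + (2 * n) * ((n - q - 1) * q)" "q + 1"] by linarith
  then have "n * (G * (n - q - 1)) \<le> n * ((q + 1) * (B * (n - 1) + 2 * ((n - q - 1) * q)))"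
    by (simp add: algebra_simps)
  then have "G * (n - q - 1) \<le> (q + 1) * (B * (n - 1) + 2 * ((n - q - 1) * q))"
    using n qq q_ge by simp
  moreover have "G * (n - q - 1) - (q + 1) * (B * (n - 1) + 2 * ((n - q - 1) * q)) =
      q * ((n - q - 1) * (n - q - 1 - 2 * (q + 1)) - q * (q + 1)^2)"
    unfolding G_def B_def by algebra
  moreover have "0 < (n - q - 1) * (n - q - 1 - 2 * (q + 1)) - q * (q + 1)^2"
  proof -
    \<comment> \<open>Both factors are replaced by their values at the least possible
      \<open>n\<close>, namely \<open>q^2 - 2 * q + 1\<close>.\<close>
    have "(q^2 - 3 * q) * (q^2 - 5 * q - 2) \<le> (n - q - 1) * (n - q - 1 - 2 * (q + 1))"
      using n qq q_ge by (intro mult_mono) auto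
    moreover have "(q^2 - 3 * q) * (q^2 - 5 * q - 2) - q * (q + 1)^2 =
        q * (q^2 * (q - 9) + 11 * q + 5)"
      by algebra
    moreover have "0 < q * (q^2 * (q - 9) + 11 * q + 5)"
      using q_ge by (intro mult_pos_pos add_nonneg_pos add_nonneg_nonneg) auto
    ultimately show ?thesis by linarith
  qed
  ultimately show False using q_ge by (smt (verit) mult_pos_pos)
qed

text \<open>The total weight is \<open>(q^2 + 1) * (x - (q + 1)^2)\<close>. It cannot be negative,
  and if it is zero then so is every weight.\<close>

lemma x_ge_of_full:
  assumes "T = Pt"
  shows "(q + 1)^2 \<le> x" and "x = (q + 1)^2 \<Longrightarrow> S \<in> Ln \<Longrightarrow> w S = 0"
proof -
  have n: "n = (q + 1) * (q^2 + 1)" using card_Pt n_def assms by metis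
  have e: "(\<Sum>S\<in>Ln. w S) = (q^2 + 1) * (x - (q + 1)^2)" unfolding sum_w n by algebra
  have "0 \<le> (\<Sum>S\<in>Ln. w S)" by (intro sum_nonneg w_nonneg)
  moreover have "0 < q^2 + 1" using q_ge by (simp add: add_nonneg_pos)
  ultimately show "(q + 1)^2 \<le> x" unfolding e by (simp add: zero_le_mult_iff)
  show "w S = 0" if "x = (q + 1)^2" "S \<in> Ln"
  proof -
    have "(\<Sum>S\<in>Ln. w S) = 0" using e that by simp
    then show ?thesis using sum_nonneg_eq_0_iff[of Ln w] fin_Ln w_nonneg that by simp
  qed
qed

lemma n_le_x: "T \<noteq> Pt \<Longrightarrow> n \<le> x"
proof -
  assume "T \<noteq> Pt"
  then obtain p where p: "p \<in> Pt" "p \<notin> T" using T_sub by auto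
  have "0 \<le> (\<Sum>S\<in>{S\<in>Ln. inc p S}. w S)" by (intro sum_nonneg w_nonneg) auto
  then show ?thesis using w_pencil[OF p(1)] p(2) by (simp add: n_def)
qed

text \<open>The deficiency \<open>q + 1 - w S - k S\<close> sums to \<open>(q + 1)\<^sup>2 - x\<close> on the lines through a
  point of \<open>T\<close>, and to at least as much on the lines through a point off \<open>T\<close> that lies on no
  secant. There are too many points of the second kind.\<close>

lemma n_ne_Suc_q:
  assumes x: "x < (q + 1)^2" and max: "\<And>S. S \<in> Ln \<Longrightarrow> w S + k S \<le> n"
  shows "n \<noteq> q + 1"
proof
  assume n: "n = q + 1"
  define y where "y = (q + 1)^2 - x"
  define d where "d S = q + 1 - w S - k S" for S
  \<comment> \<open>The deficiency restricted to lines with exactly one point in \<open>T\<close>: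
    these carry it from the points of \<open>T\<close> to the points off \<open>T\<close>. The set
    \<open>bad\<close> consists of the points off \<open>T\<close> on some secant.\<close>
  define D where "D S = (if k S = 1 then d S else 0)" for S
  define bad where "bad = {p\<in>Pt - T. \<exists>S\<in>Ln. inc p S \<and> 2 \<le> k S}"
  define good where "good = Pt - T - bad"
  have y: "y > 0" using x by (simp add: y_def)
  have d: "d S \<ge> 0" if "S \<in> Ln" for S using max[OF that] n by (simp add: d_def)
  have D: "D S \<ge> 0" if "S \<in> Ln" for S using d[OF that] by (simp add: D_def)
  have off: "int (card {p\<in>Pt - T. inc p S}) = q + 1 - k S" if "S \<in> Ln" for S
  proof -
    have "{p\<in>Pt - T. inc p S} = {p\<in>Pt. inc p S} - {p\<in>T. inc p S}" by auto
    moreover have "{p\<in>T. inc p S} \<subseteq> {p\<in>Pt. inc p S}" using T_sub by auto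
    ultimately show ?thesis
      using card_line[OF that] fin_T fin_Pt
      by (simp add: card_Diff_subset k_def card_mono of_nat_diff)
  qed
  have dT: "(\<Sum>S\<in>{S\<in>Ln. inc p S}. d S) = y" if "p \<in> T" for p
  proof -
    have pP: "p \<in> Pt" using that T_sub by auto
    have "(\<Sum>S\<in>{S\<in>Ln. inc p S}. d S) =
        (q + 1) * int (card {S\<in>Ln. inc p S}) - (\<Sum>S\<in>{S\<in>Ln. inc p S}. w S)
          - (\<Sum>S\<in>{S\<in>Ln. inc p S}. k S)"
      by (simp add: d_def sum_subtractf)
    also have "\<dots> = (q + 1) * (q^2 + q + 1) - (x - n + (q^3 - q)) - (n + (q^2 + q))"
      using that card_pencil[OF pP] w_pencil[OF pP] sum_k_pencil[OF pP] by (simp add: n_def)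
    also have "\<dots> = y" unfolding y_def by algebra
    finally show ?thesis .
  qed
  \<comment> \<open>A line with one point in \<open>T\<close> has \<open>q\<close> points off
    \<open>T\<close>, and the sum of \<open>d S * k S\<close> is \<open>y\<close> for each of the
    \<open>q + 1\<close> points of \<open>T\<close>.\<close>
  have sumD: "(\<Sum>p\<in>Pt - T. \<Sum>S\<in>{S\<in>Ln. inc p S}. D S) \<le> q * ((q + 1) * y)"
  proof -
    have "(\<Sum>p\<in>Pt - T. \<Sum>S\<in>{S\<in>Ln. inc p S}. D S) =
        (\<Sum>S\<in>Ln. D S * int (card {p\<in>Pt - T. inc p S}))"
      by (rule sum_swap_card) (auto simp: fin_Pt fin_Ln)
    also have "\<dots> \<le> (\<Sum>S\<in>Ln. q * (d S * k S))"
    proof (rule sum_mono)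
      fix S assume S: "S \<in> Ln"
      show "D S * int (card {p\<in>Pt - T. inc p S}) \<le> q * (d S * k S)"
        unfolding off[OF S] using d[OF S] k_nonneg[of S] q_ge by (auto simp: D_def)
    qed
    also have "\<dots> = q * (\<Sum>p\<in>T. y)"
      unfolding sum_distrib_left[symmetric] sum_k_times using dT by simp
    also have "\<dots> = q * ((q + 1) * y)" using n by (simp add: n_def)
    finally show ?thesis .
  qed
  have "(\<Sum>p\<in>good. y) \<le> (\<Sum>p\<in>good. \<Sum>S\<in>{S\<in>Ln. inc p S}. D S)"
  proof (rule sum_mono)
    fix p assume p: "p \<in> good"
    then have pP: "p \<in> Pt" "p \<notin> T" by (auto simp: good_def)
    let ?P = "{S\<in>Ln. inc p S}"
    have k1: "k S = 0 \<or> k S = 1" if "S \<in> ?P" for S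
      using p that k_nonneg[of S] by (force simp: good_def bad_def)
    \<comment> \<open>On a line with \<open>k S = 1\<close> the two terms agree; on a line with
      \<open>k S = 0\<close> the left one is 0 and the right one is \<open>- w S\<close>.\<close>
    have "(\<Sum>S\<in>?P. D S) \<ge> (\<Sum>S\<in>?P. q * k S - w S)"
    proof (rule sum_mono)
      fix S assume S: "S \<in> ?P"
      then show "q * k S - w S \<le> D S"
        using k1[OF S] w_nonneg[of S] by (auto simp: D_def d_def)
    qed
    also have "(\<Sum>S\<in>?P. q * k S - w S) = q * n - (x - n)"
      using sum_k_pencil[OF pP(1)] w_pencil[OF pP(1)] pP(2)
      by (simp add: sum_subtractf n_def flip: sum_distrib_left)
    also have "\<dots> = y" unfolding y_def n by algebra
    finally show "y \<le> (\<Sum>S\<in>?P. D S)" .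
  qed
  also have "\<dots> \<le> (\<Sum>p\<in>Pt - T. \<Sum>S\<in>{S\<in>Ln. inc p S}. D S)"
    by (rule sum_mono2) (auto simp: good_def fin_Pt intro!: sum_nonneg D)
  finally have "int (card good) * y \<le> (q * (q + 1)) * y" using sumD by simp
  then have good: "int (card good) \<le> q * (q + 1)" using y by simp
  \<comment> \<open>A secant has at most \<open>q - 1\<close> points off \<open>T\<close> and
    accounts for at least two ordered pairs of points of \<open>T\<close>, of which there are
    \<open>q * (q + 1)\<close>.\<close>
  have "2 * int (card bad) \<le> (q - 1) * (q * (q + 1))"
  proof -
    have "int (card bad) = (\<Sum>p\<in>bad. 1)" by simp
    also have "\<dots> \<le> (\<Sum>p\<in>bad. int (card {S\<in>{S\<in>Ln. 2 \<le> k S}. inc p S}))"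
    proof (rule sum_mono)
      fix p assume "p \<in> bad"
      then have "{S\<in>{S\<in>Ln. 2 \<le> k S}. inc p S} \<noteq> {}" by (auto simp: bad_def)
      then have "card {S\<in>{S\<in>Ln. 2 \<le> k S}. inc p S} > 0"
        using fin_Ln by (simp add: card_gt_0_iff)
      then show "1 \<le> int (card {S\<in>{S\<in>Ln. 2 \<le> k S}. inc p S})" by simp
    qed
    also have "\<dots> \<le> (\<Sum>p\<in>Pt - T. int (card {S\<in>{S\<in>Ln. 2 \<le> k S}. inc p S}))"
      by (rule sum_mono2) (auto simp: bad_def fin_Pt)
    also have "\<dots> = (\<Sum>S\<in>{S\<in>Ln. 2 \<le> k S}. int (card {p\<in>Pt - T. inc p S}))"
      by (rule sum_card_swap) (auto simp: fin_Pt fin_Ln)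
    finally have "2 * int (card bad) \<le> 2 * (\<Sum>S\<in>{S\<in>Ln. 2 \<le> k S}. int (card {p\<in>Pt - T. inc p S}))"
      by simp
    also have "\<dots> \<le> (\<Sum>S\<in>{S\<in>Ln. 2 \<le> k S}. (q - 1) * (k S * (k S - 1)))"
      unfolding sum_distrib_left
    proof (rule sum_mono)
      fix S assume S: "S \<in> {S\<in>Ln. 2 \<le> k S}"
      have "2 * 1 \<le> k S * (k S - 1)" using S by (intro mult_mono) auto
      then have "(q - 1) * 2 \<le> (q - 1) * (k S * (k S - 1))"
        using q_ge by (intro mult_left_mono) auto
      then show "2 * int (card {p\<in>Pt - T. inc p S}) \<le> (q - 1) * (k S * (k S - 1))"
        using off[of S] S by simp
    qed
    also have "\<dots> \<le> (\<Sum>S\<in>Ln. (q - 1) * (k S * (k S - 1)))"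
    proof (rule sum_mono2)
      fix S
      have "0 \<le> k S * (k S - 1)" using k_nonneg[of S] by (cases "k S = 0") auto
      then show "0 \<le> (q - 1) * (k S * (k S - 1))" using q_ge by simp
    qed (auto simp: fin_Ln)
    also have "\<dots> = (q - 1) * (q * (q + 1))"
      by (simp add: sum_pairs n mult.commute flip: sum_distrib_left)
    finally show ?thesis .
  qed
  moreover have "int (card good) + int (card bad) = q^2 * (q + 1)"
  proof -
    have "card good + card bad = card (good \<union> bad)"
      by (rule card_Un_disjoint[symmetric]) (auto simp: good_def bad_def fin_Pt)
    also have "good \<union> bad = Pt - T" by (auto simp: good_def bad_def)
    finally have "int (card good) + int (card bad) = int (card (Pt - T))" by simp
    also have "\<dots> = (q + 1) * (q^2 + 1) - (q + 1)"
      using T_sub fin_T fin_Pt n card_Pt by (simp add: card_Diff_subset of_nat_diff card_mono n_def)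
    finally show ?thesis by (simp add: algebra_simps)
  qed
  ultimately have "2 * (q^2 * (q + 1)) \<le> 2 * (q * (q + 1)) + (q - 1) * (q * (q + 1))"
    using good by linarith
  then have "(q * (q + 1)) * (2 * q) \<le> (q * (q + 1)) * (q + 1)"
    by (simp add: algebra_simps power2_eq_square)
  then show False using q_ge by simp
qed

end

section \<open>The lattice of subspaces\<close>

text \<open>The function \<open>dm\<close> is the vector space dimension. The axioms are chosen to
  survive reversal of the order; the one whose dual needs a real proof is
  \<open>card_covers\<close>, and \<open>card_cocovers\<close> supplies it.\<close>

locale subspace_lattice =
  fixes q :: int and X :: "'b set" and le :: "'b \<Rightarrow> 'b \<Rightarrow> bool" (infix "\<sqsubseteq>" 50)
    and dm :: "'b \<Rightarrow> nat" and mt :: "'b \<Rightarrow> 'b \<Rightarrow> 'b" (infixl "\<sqinter>" 70)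
    and jn :: "'b \<Rightarrow> 'b \<Rightarrow> 'b" (infixl "\<squnion>" 65)
  assumes q_ge: "q \<ge> 9"
    and fin_X: "finite X"
    and le_refl: "a \<sqsubseteq> a"
    and le_antisym: "\<lbrakk>a \<sqsubseteq> b; b \<sqsubseteq> a\<rbrakk> \<Longrightarrow> a = b"
    and le_trans: "\<lbrakk>a \<sqsubseteq> b; b \<sqsubseteq> c\<rbrakk> \<Longrightarrow> a \<sqsubseteq> c"
    and mt_X: "\<lbrakk>a \<in> X; b \<in> X\<rbrakk> \<Longrightarrow> a \<sqinter> b \<in> X"
    and mt_le1: "\<lbrakk>a \<in> X; b \<in> X\<rbrakk> \<Longrightarrow> a \<sqinter> b \<sqsubseteq> a"
    and mt_le2: "\<lbrakk>a \<in> X; b \<in> X\<rbrakk> \<Longrightarrow> a \<sqinter> b \<sqsubseteq> b"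
    and mt_greatest: "\<lbrakk>a \<in> X; b \<in> X; c \<in> X; c \<sqsubseteq> a; c \<sqsubseteq> b\<rbrakk> \<Longrightarrow> c \<sqsubseteq> a \<sqinter> b"
    and jn_X: "\<lbrakk>a \<in> X; b \<in> X\<rbrakk> \<Longrightarrow> a \<squnion> b \<in> X"
    and jn_ge1: "\<lbrakk>a \<in> X; b \<in> X\<rbrakk> \<Longrightarrow> a \<sqsubseteq> a \<squnion> b"
    and jn_ge2: "\<lbrakk>a \<in> X; b \<in> X\<rbrakk> \<Longrightarrow> b \<sqsubseteq> a \<squnion> b"
    and jn_least: "\<lbrakk>a \<in> X; b \<in> X; c \<in> X; a \<sqsubseteq> c; b \<sqsubseteq> c\<rbrakk> \<Longrightarrow> a \<squnion> b \<sqsubseteq> c"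
    and modular: "\<lbrakk>a \<in> X; b \<in> X\<rbrakk> \<Longrightarrow> dm (a \<sqinter> b) + dm (a \<squnion> b) = dm a + dm b"
    and dm_mono: "\<lbrakk>a \<in> X; b \<in> X; a \<sqsubseteq> b\<rbrakk> \<Longrightarrow> dm a \<le> dm b"
    and dm_eq: "\<lbrakk>a \<in> X; b \<in> X; a \<sqsubseteq> b; dm a = dm b\<rbrakk> \<Longrightarrow> a = b"
    and dm_le: "a \<in> X \<Longrightarrow> dm a \<le> 6"
    and ex_top: "\<exists>t\<in>X. dm t = 6 \<and> (\<forall>a\<in>X. a \<sqsubseteq> t)"
    and ex_bot: "\<exists>z\<in>X. dm z = 0 \<and> (\<forall>a\<in>X. z \<sqsubseteq> a)"
    and card_covers: "\<lbrakk>a \<in> X; b \<in> X; a \<sqsubseteq> b\<rbrakk> \<Longrightarrow>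
      int (card {c\<in>X. a \<sqsubseteq> c \<and> c \<sqsubseteq> b \<and> dm c = dm a + 1}) = (\<Sum>i<dm b - dm a. q^i)"
begin

text \<open>Induction on the length of the interval: counting pairs of an atom below a coatom shows
  that the interval has as many coatoms as atoms, and \<open>card_covers\<close> counts the
  atoms.\<close>

lemma card_cocovers:
  assumes "a \<in> X" "b \<in> X" "a \<sqsubseteq> b"
  shows "int (card {c\<in>X. a \<sqsubseteq> c \<and> c \<sqsubseteq> b \<and> dm b = dm c + 1}) = (\<Sum>i<dm b - dm a. q^i)"
  using assms
proof (induction "dm b - dm a" arbitrary: a)
  case 0
  then have "dm b \<le> dm c" if "c \<in> X" "a \<sqsubseteq> c" for c using dm_mono[of a c] that by linarith
  then have e: "{c\<in>X. a \<sqsubseteq> c \<and> c \<sqsubseteq> b \<and> dm b = dm c + 1} = {}" by fastforce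
  show ?case unfolding e using 0 by simp
next
  case (Suc e)
  let ?H = "{c\<in>X. a \<sqsubseteq> c \<and> c \<sqsubseteq> b \<and> dm b = dm c + 1}"
  let ?P = "{c\<in>X. a \<sqsubseteq> c \<and> c \<sqsubseteq> b \<and> dm c = dm a + 1}"
  show ?case
  \<comment> \<open>For \<open>e = 0\<close> the sum that is cancelled in the other case is empty,
    hence zero.\<close>
  proof (cases "e = 0")
    case True
    then have b: "dm b = dm a + 1" using Suc by linarith
    have "?H = {a}"
    proof -
      have "c = a" if "c \<in> ?H" for c using that b dm_eq[of a c] Suc by auto
      moreover have "a \<in> ?H" using Suc b le_refl by auto
      ultimately show ?thesis by blast
    qed
    then show ?thesis by (simp add: b)
  next
    case False
    have ab: "dm b - dm a = Suc e" "dm b = dm a + Suc e" using Suc by linarith+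
    have "(\<Sum>h\<in>?H. int (card {p\<in>?P. p \<sqsubseteq> h})) = (\<Sum>h\<in>?H. \<Sum>i<e. q^i)"
    proof (rule sum.cong[OF refl])
      fix h assume h: "h \<in> ?H"
      then have "{p\<in>?P. p \<sqsubseteq> h} = {c\<in>X. a \<sqsubseteq> c \<and> c \<sqsubseteq> h \<and> dm c = dm a + 1}"
        using le_trans by blast
      moreover have "dm h - dm a = e" using h ab by auto
      ultimately show "int (card {p\<in>?P. p \<sqsubseteq> h}) = (\<Sum>i<e. q^i)"
        using card_covers[of a h] h Suc by simp
    qed
    moreover have "(\<Sum>p\<in>?P. int (card {h\<in>?H. p \<sqsubseteq> h})) = (\<Sum>p\<in>?P. \<Sum>i<e. q^i)"
    proof (rule sum.cong[OF refl])
      fix p assume p: "p \<in> ?P"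
      then have "{h\<in>?H. p \<sqsubseteq> h} = {c\<in>X. p \<sqsubseteq> c \<and> c \<sqsubseteq> b \<and> dm b = dm c + 1}"
        using le_trans by blast
      moreover have "e = dm b - dm p" using p ab by auto
      ultimately show "int (card {h\<in>?H. p \<sqsubseteq> h}) = (\<Sum>i<e. q^i)"
        using Suc.hyps(1)[of p] p Suc.prems by simp
    qed
    moreover have "(\<Sum>h\<in>?H. int (card {p\<in>?P. p \<sqsubseteq> h})) = (\<Sum>p\<in>?P. int (card {h\<in>?H. p \<sqsubseteq> h}))"
      by (rule sum_card_swap) (auto simp: fin_X)
    moreover have "(\<Sum>i<e. q^i) > 0" using False q_ge by (intro sum_pos) auto
    ultimately have "int (card ?H) = int (card ?P)" by simp
    then show ?thesis using card_covers[of a b] Suc.prems by simp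
  qed
qed

text \<open>The dual projective space: dimension becomes codimension, and meet and join trade
  places. By \<open>dm_le\<close> the subtraction from 6 is never truncated.\<close>

lemma dual: "subspace_lattice q X (\<lambda>a b. b \<sqsubseteq> a) (\<lambda>a. 6 - dm a) (\<squnion>) (\<sqinter>)"
proof
  fix a b assume ab: "a \<in> X" "b \<in> X"
  show "6 - dm (a \<squnion> b) + (6 - dm (a \<sqinter> b)) = 6 - dm a + (6 - dm b)"
    using modular[OF ab] dm_le[OF ab(1)] dm_le[OF ab(2)] dm_le[OF mt_X[OF ab]]
      dm_le[OF jn_X[OF ab]] by linarith
next
  fix a b assume ab: "a \<in> X" "b \<in> X" "b \<sqsubseteq> a"
  have "{c\<in>X. c \<sqsubseteq> a \<and> b \<sqsubseteq> c \<and> 6 - dm c = 6 - dm a + 1} =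
      {c\<in>X. b \<sqsubseteq> c \<and> c \<sqsubseteq> a \<and> dm a = dm c + 1}"
  proof -
    have "6 - dm c = 6 - dm a + 1 \<longleftrightarrow> dm a = dm c + 1" if "c \<in> X" for c
      using dm_le[OF that] dm_le[OF ab(1)] by linarith
    then show ?thesis by blast
  qed
  moreover have "6 - dm b - (6 - dm a) = dm a - dm b"
    using dm_le[OF ab(1)] dm_le[OF ab(2)] by linarith
  ultimately show "int (card {c\<in>X. c \<sqsubseteq> a \<and> b \<sqsubseteq> c \<and> 6 - dm c = 6 - dm a + 1}) =
      (\<Sum>i<6 - dm b - (6 - dm a). q^i)"
    using card_cocovers[of b a] ab by simp
next
  fix a b assume "a \<in> X" "b \<in> X" "b \<sqsubseteq> a" "6 - dm a = 6 - dm b"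
  moreover from this have "dm b = dm a" using dm_le[of a] dm_le[of b] by simp
  ultimately show "a = b" using dm_eq[of b a] by simp
next
  show "\<exists>t\<in>X. 6 - dm t = 6 \<and> (\<forall>a\<in>X. t \<sqsubseteq> a)"
    using ex_bot by (metis diff_zero)
next
  show "\<exists>z\<in>X. 6 - dm z = 0 \<and> (\<forall>a\<in>X. a \<sqsubseteq> z)"
    using ex_top by (metis diff_self_eq_0)
next
  fix a b assume "a \<in> X" "b \<in> X" "b \<sqsubseteq> a"
  then show "6 - dm a \<le> 6 - dm b" using dm_mono by (simp add: diff_le_mono2)
qed (rule q_ge fin_X le_refl jn_X jn_ge1 jn_ge2 jn_least mt_X mt_le1 mt_le2 mt_greatest diff_le_self
  | erule (1) le_antisym | erule (1) le_trans | assumption)+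

section \<open>Counting lines, planes, solids and hyperplanes, which are \<open>F 2\<close>,
  \<open>F 3\<close>, \<open>F 4\<close> and \<open>F 5\<close>\<close>

definition F :: "nat \<Rightarrow> 'b set" where "F d = {a\<in>X. dm a = d}"

lemma fin_F: "finite (F d)" by (simp add: F_def fin_X)

lemma F_X: "a \<in> F d \<Longrightarrow> a \<in> X" and F_dm: "a \<in> F d \<Longrightarrow> dm a = d"
  by (auto simp: F_def)

lemma card_F_between:
  assumes "a \<in> F d" "b \<in> F e" "a \<sqsubseteq> b"
  shows "int (card {c\<in>F (Suc d). a \<sqsubseteq> c \<and> c \<sqsubseteq> b}) = (\<Sum>i<e - d. q^i)"
proof -
  have "{c\<in>F (Suc d). a \<sqsubseteq> c \<and> c \<sqsubseteq> b} = {c\<in>X. a \<sqsubseteq> c \<and> c \<sqsubseteq> b \<and> dm c = dm a + 1}"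
    using assms by (auto simp: F_def)
  then show ?thesis using card_covers[of a b] assms by (simp add: F_def)
qed

lemma card_F_above:
  assumes "a \<in> F d"
  shows "int (card {c\<in>F (Suc d). a \<sqsubseteq> c}) = (\<Sum>i<6 - d. q^i)"
proof -
  obtain t where t: "t \<in> F 6" "\<And>a. a \<in> X \<Longrightarrow> a \<sqsubseteq> t" using ex_top by (auto simp: F_def)
  have "{c\<in>F (Suc d). a \<sqsubseteq> c} = {c\<in>F (Suc d). a \<sqsubseteq> c \<and> c \<sqsubseteq> t}" using t F_X by auto
  then show ?thesis using card_F_between[OF assms t(1)] t(2) assms F_X by simp
qed

lemma card_F_below:
  assumes "b \<in> F (Suc d)"
  shows "int (card {c\<in>F d. c \<sqsubseteq> b}) = (\<Sum>i<Suc d. q^i)"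
proof -
  obtain z where z: "z \<in> F 0" "\<And>a. a \<in> X \<Longrightarrow> z \<sqsubseteq> a" using ex_bot by (auto simp: F_def)
  have "{c\<in>F d. c \<sqsubseteq> b} = {c\<in>X. z \<sqsubseteq> c \<and> c \<sqsubseteq> b \<and> dm b = dm c + 1}"
    using assms z by (auto simp: F_def)
  then show ?thesis using card_cocovers[of z b] assms z by (simp add: F_def)
qed

lemma card_planes_above_line: "l \<in> F 2 \<Longrightarrow> int (card {p\<in>F 3. l \<sqsubseteq> p}) = (q + 1) * (q^2 + 1)"
  using card_F_above[of l 2] by (simp add: eval_nat_numeral algebra_simps)

lemma card_solids_above_plane: "p \<in> F 3 \<Longrightarrow> int (card {S\<in>F 4. p \<sqsubseteq> S}) = q^2 + q + 1"
  using card_F_above[of p 3] by (simp add: eval_nat_numeral algebra_simps)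

lemma card_hyperplanes_above_solid: "S \<in> F 4 \<Longrightarrow> int (card {H\<in>F 5. S \<sqsubseteq> H}) = q + 1"
  using card_F_above[of S 4] by (simp add: eval_nat_numeral algebra_simps)

lemma card_planes_between_line_solid:
  "\<lbrakk>l \<in> F 2; S \<in> F 4; l \<sqsubseteq> S\<rbrakk> \<Longrightarrow> int (card {p\<in>F 3. l \<sqsubseteq> p \<and> p \<sqsubseteq> S}) = q + 1"
  using card_F_between[of l 2 S 4] by (simp add: eval_nat_numeral algebra_simps)

lemma card_planes_between_line_hyperplane:
  "\<lbrakk>l \<in> F 2; H \<in> F 5; l \<sqsubseteq> H\<rbrakk> \<Longrightarrow> int (card {p\<in>F 3. l \<sqsubseteq> p \<and> p \<sqsubseteq> H}) = q^2 + q + 1"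
  using card_F_between[of l 2 H 5] by (simp add: eval_nat_numeral algebra_simps)

lemma card_solids_between_plane_hyperplane:
  "\<lbrakk>p \<in> F 3; H \<in> F 5; p \<sqsubseteq> H\<rbrakk> \<Longrightarrow> int (card {S\<in>F 4. p \<sqsubseteq> S \<and> S \<sqsubseteq> H}) = q + 1"
  using card_F_between[of p 3 H 5] by (simp add: eval_nat_numeral algebra_simps)

lemma card_planes_below_solid: "S \<in> F 4 \<Longrightarrow> int (card {p\<in>F 3. p \<sqsubseteq> S}) = (q + 1) * (q^2 + 1)"
  using card_F_below[of S 3] by (simp add: eval_nat_numeral algebra_simps)

text \<open>Counts pairs of a plane inside a solid inside \<open>H\<close>; the solids of
  \<open>H\<close> are counted directly by \<open>card_F_below\<close>.\<close>

lemma card_planes_below_hyperplane: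
  assumes H: "H \<in> F 5"
  shows "int (card {p\<in>F 3. p \<sqsubseteq> H}) = (q^2 + 1) * (q^4 + q^3 + q^2 + q + 1)"
proof -
  let ?P = "{p\<in>F 3. p \<sqsubseteq> H}" and ?S = "{S\<in>F 4. S \<sqsubseteq> H}"
  have "(\<Sum>p\<in>?P. int (card {S\<in>?S. p \<sqsubseteq> S})) = (\<Sum>p\<in>?P. q + 1)"
  proof (rule sum.cong[OF refl])
    fix p assume "p \<in> ?P"
    moreover have "{S\<in>?S. p \<sqsubseteq> S} = {S\<in>F 4. p \<sqsubseteq> S \<and> S \<sqsubseteq> H}" by auto
    ultimately show "int (card {S\<in>?S. p \<sqsubseteq> S}) = q + 1"
      using card_solids_between_plane_hyperplane H by simp
  qed
  moreover have "(\<Sum>S\<in>?S. int (card {p\<in>?P. p \<sqsubseteq> S})) = (\<Sum>S\<in>?S. (q + 1) * (q^2 + 1))"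
  proof (rule sum.cong[OF refl])
    fix S assume "S \<in> ?S"
    moreover from this have "{p\<in>?P. p \<sqsubseteq> S} = {p\<in>F 3. p \<sqsubseteq> S}" using le_trans by auto
    ultimately show "int (card {p\<in>?P. p \<sqsubseteq> S}) = (q + 1) * (q^2 + 1)"
      using card_planes_below_solid by simp
  qed
  moreover have "(\<Sum>p\<in>?P. int (card {S\<in>?S. p \<sqsubseteq> S})) = (\<Sum>S\<in>?S. int (card {p\<in>?P. p \<sqsubseteq> S}))"
    by (rule sum_card_swap) (auto simp: fin_F)
  ultimately have "(q + 1) * int (card ?P) = (q + 1) * ((q^2 + 1) * int (card ?S))"
    by (simp add: algebra_simps)
  moreover have "int (card ?S) = q^4 + q^3 + q^2 + q + 1"
    using card_F_below[of H 4] H by (simp add: eval_nat_numeral algebra_simps)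
  ultimately show ?thesis using q_ge by (simp add: mult.commute)
qed

lemma dm_mt_less:
  assumes "a \<in> F d" "b \<in> F d" "a \<noteq> b"
  shows "dm (a \<sqinter> b) < d"
proof -
  have X: "a \<in> X" "b \<in> X" and d: "dm a = d" "dm b = d" using assms by (auto simp: F_def)
  have "dm (a \<sqinter> b) \<le> d" using dm_mono[OF mt_X[OF X] X(1) mt_le1[OF X]] d by simp
  moreover have "dm (a \<sqinter> b) \<noteq> d"
  proof
    assume e: "dm (a \<sqinter> b) = d"
    have "a \<sqinter> b = a" by (rule dm_eq[OF mt_X[OF X] X(1) mt_le1[OF X]]) (simp add: d e)
    moreover have "a \<sqinter> b = b" by (rule dm_eq[OF mt_X[OF X] X(2) mt_le2[OF X]]) (simp add: d e)
    ultimately show False using assms(3) by simp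
  qed
  ultimately show ?thesis by simp
qed

text \<open>A solid on two distinct planes must be their join, and since the dimensions of meet and
  join add up to 6, the join is a solid exactly if the planes meet in a line.\<close>

lemma card_solids_above_planes:
  assumes "p \<in> F 3" "p' \<in> F 3" "p \<noteq> p'"
  shows "card {S\<in>F 4. p \<sqsubseteq> S \<and> p' \<sqsubseteq> S} = (if dm (p \<sqinter> p') = 2 then 1 else 0)"
proof -
  have X: "p \<in> X" "p' \<in> X" using assms F_X by auto
  have eq: "dm (p \<sqinter> p') + dm (p \<squnion> p') = 6" using modular[OF X] assms F_dm by simp
  have lt: "dm (p \<sqinter> p') < 3" by (rule dm_mt_less[OF assms])
  have jn: "S = p \<squnion> p' \<and> dm (p \<sqinter> p') = 2" if S: "S \<in> F 4" "p \<sqsubseteq> S" "p' \<sqsubseteq> S" for S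
  proof -
    have le: "p \<squnion> p' \<sqsubseteq> S" by (rule jn_least[OF X F_X[OF S(1)] S(2,3)])
    have "dm (p \<squnion> p') \<le> 4" using dm_mono[OF jn_X[OF X] F_X[OF S(1)] le] F_dm[OF S(1)] by simp
    then have d: "dm (p \<sqinter> p') = 2" "dm (p \<squnion> p') = 4" using eq lt by linarith+
    have "p \<squnion> p' = S"
      by (rule dm_eq[OF jn_X[OF X] F_X[OF S(1)] le]) (simp add: d F_dm[OF S(1)])
    then show ?thesis using d by simp
  qed
  show ?thesis
  proof (cases "dm (p \<sqinter> p') = 2")
    case True
    then have "p \<squnion> p' \<in> F 4" using eq jn_X[OF X] by (simp add: F_def)
    then have "{S\<in>F 4. p \<sqsubseteq> S \<and> p' \<sqsubseteq> S} = {p \<squnion> p'}"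
      using jn jn_ge1[OF X] jn_ge2[OF X] by blast
    then show ?thesis using True by simp
  next
    case False
    then have e: "{S\<in>F 4. p \<sqsubseteq> S \<and> p' \<sqsubseteq> S} = {}" using jn by blast
    show ?thesis unfolding e using False by simp
  qed
qed

lemma dm_mt_planes_above_line:
  assumes "l \<in> F 2" "p \<in> F 3" "p' \<in> F 3" "p \<noteq> p'" "l \<sqsubseteq> p" "l \<sqsubseteq> p'"
  shows "dm (p \<sqinter> p') = 2"
proof -
  have X: "p \<in> X" "p' \<in> X" "l \<in> X" using assms F_X by auto
  have "l \<sqsubseteq> p \<sqinter> p'" by (rule mt_greatest[OF X assms(5,6)])
  then have "dm (p \<sqinter> p') \<ge> 2" using dm_mono[OF X(3) mt_X[OF X(1,2)]] F_dm[OF assms(1)] by simp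
  then show ?thesis using dm_mt_less[OF assms(2,3,4)] by linarith
qed

lemma quotient_linear_space:
  assumes l: "l \<in> F 2" and L: "L \<subseteq> F 3"
  shows "linear_space q {p\<in>F 3. l \<sqsubseteq> p} {p\<in>L. l \<sqsubseteq> p} {S\<in>F 4. l \<sqsubseteq> S} (\<sqsubseteq>)"
proof
  fix p p' assume p: "p \<in> {p\<in>F 3. l \<sqsubseteq> p}" "p' \<in> {p\<in>F 3. l \<sqsubseteq> p}" "p \<noteq> p'"
  have "{S\<in>{S\<in>F 4. l \<sqsubseteq> S}. p \<sqsubseteq> S \<and> p' \<sqsubseteq> S} = {S\<in>F 4. p \<sqsubseteq> S \<and> p' \<sqsubseteq> S}"
    using p le_trans by blast
  then show "card {S\<in>{S\<in>F 4. l \<sqsubseteq> S}. p \<sqsubseteq> S \<and> p' \<sqsubseteq> S} = 1"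
    using card_solids_above_planes[of p p'] dm_mt_planes_above_line[OF l, of p p'] p by simp
next
  fix S assume S: "S \<in> {S\<in>F 4. l \<sqsubseteq> S}"
  have "{p\<in>{p\<in>F 3. l \<sqsubseteq> p}. p \<sqsubseteq> S} = {p\<in>F 3. l \<sqsubseteq> p \<and> p \<sqsubseteq> S}" by auto
  then show "int (card {p\<in>{p\<in>F 3. l \<sqsubseteq> p}. p \<sqsubseteq> S}) = q + 1"
    using card_planes_between_line_solid[OF l, of S] S by simp
next
  fix p assume p: "p \<in> {p\<in>F 3. l \<sqsubseteq> p}"
  then have "{S\<in>{S\<in>F 4. l \<sqsubseteq> S}. p \<sqsubseteq> S} = {S\<in>F 4. p \<sqsubseteq> S}" using le_trans by blast
  then show "int (card {S\<in>{S\<in>F 4. l \<sqsubseteq> S}. p \<sqsubseteq> S}) = q^2 + q + 1"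
    using card_solids_above_plane[of p] p by simp
qed (use q_ge fin_F L l card_planes_above_line in auto)

end

section \<open>Regular sets of planes\<close>

text \<open>Both regularity hypotheses are merged into one; for \<open>p\<close> outside
  \<open>L\<close> the condition \<open>s \<noteq> p\<close> holds automatically.\<close>

locale regular_planes = subspace_lattice q X le dm mt jn
  for q :: int and X :: "'b set" and le (infix "\<sqsubseteq>" 50) and dm and mt (infixl "\<sqinter>" 70)
    and jn (infixl "\<squnion>" 65) +
  fixes L :: "'b set" and x :: int
  assumes L_sub: "L \<subseteq> F 3"
    and card_L: "int (card L) = x * (q^2 + 1) * (q^2 - q + 1)"
    and regular: "p \<in> F 3 \<Longrightarrow> int (card {s\<in>L. s \<noteq> p \<and> dm (p \<sqinter> s) = 2}) =
      x + (if p \<in> L then q^3 - q - 1 else 0)"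
begin

lemma fin_L: "finite L" using L_sub fin_F finite_subset by blast

lemma dual_F: "d \<le> 6 \<Longrightarrow> subspace_lattice.F X (\<lambda>a. 6 - dm a) d = F (6 - d)"
  using dm_le by (auto simp: subspace_lattice.F_def[OF dual] F_def)

text \<open>Planes are self-dual in dimension 6, and two planes meet in a line exactly if they span
  a solid, so adjacency of planes is the same in the dual.\<close>

lemma dual_regular: "regular_planes q X (\<lambda>a b. b \<sqsubseteq> a) (\<lambda>a. 6 - dm a) (\<squnion>) (\<sqinter>) L x"
proof -
  interpret D: subspace_lattice q X "\<lambda>a b. b \<sqsubseteq> a" "\<lambda>a. 6 - dm a" "(\<squnion>)" "(\<sqinter>)" by (rule dual)
  show ?thesis
  proof
    show "L \<subseteq> D.F 3" using L_sub dual_F[of 3] by simp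
    show "int (card L) = x * (q^2 + 1) * (q^2 - q + 1)" by (rule card_L)
    fix p assume "p \<in> D.F 3"
    then have p: "p \<in> F 3" using dual_F[of 3] by simp
    have "6 - dm (p \<squnion> s) = 2 \<longleftrightarrow> dm (p \<sqinter> s) = 2" if "s \<in> L" for s
    proof -
      have "s \<in> F 3" using that L_sub by auto
      then have "dm (p \<sqinter> s) + dm (p \<squnion> s) = 6" using modular[of p s] p by (simp add: F_def)
      then show ?thesis by linarith
    qed
    then have "{s\<in>L. s \<noteq> p \<and> 6 - dm (p \<squnion> s) = 2} = {s\<in>L. s \<noteq> p \<and> dm (p \<sqinter> s) = 2}" by auto
    then show "int (card {s\<in>L. s \<noteq> p \<and> 6 - dm (p \<squnion> s) = 2}) =
        x + (if p \<in> L then q^3 - q - 1 else 0)"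
      using regular[OF p] by simp
  qed
qed

section \<open>Planes of \<open>L\<close> on a line, in a solid and in a hyperplane\<close>

definition deg :: "'b \<Rightarrow> int" where "deg l = int (card {s\<in>L. l \<sqsubseteq> s})"

definition codeg :: "'b \<Rightarrow> int" where "codeg S = int (card {s\<in>L. s \<sqsubseteq> S})"

text \<open>The plane \<open>p\<close>, if in \<open>L\<close>, lies in all
  \<open>q^2 + q + 1\<close> solids on \<open>p\<close>; a plane meeting \<open>p\<close> in a line
  lies in one of them, and any other plane in none.\<close>

lemma sum_codeg_above_plane:
  assumes p: "p \<in> F 3"
  shows "(\<Sum>S\<in>{S\<in>F 4. p \<sqsubseteq> S}. codeg S) = x + (if p \<in> L then q^2 * (q + 1) else 0)"
proof -
  have "(\<Sum>S\<in>{S\<in>F 4. p \<sqsubseteq> S}. codeg S) = (\<Sum>s\<in>L. int (card {S\<in>{S\<in>F 4. p \<sqsubseteq> S}. s \<sqsubseteq> S}))"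
    unfolding codeg_def by (rule sum_card_swap) (auto simp: fin_F fin_L)
  also have "\<dots> = (\<Sum>s\<in>L. (if s = p then q^2 + q + 1 else 0) +
      (if s \<noteq> p \<and> dm (p \<sqinter> s) = 2 then 1 else 0))"
  proof (rule sum.cong[OF refl])
    fix s assume s: "s \<in> L"
    have e: "{S\<in>{S\<in>F 4. p \<sqsubseteq> S}. s \<sqsubseteq> S} = {S\<in>F 4. p \<sqsubseteq> S \<and> s \<sqsubseteq> S}" by auto
    show "int (card {S\<in>{S\<in>F 4. p \<sqsubseteq> S}. s \<sqsubseteq> S}) = (if s = p then q^2 + q + 1 else 0) +
      (if s \<noteq> p \<and> dm (p \<sqinter> s) = 2 then 1 else 0)"
      using card_solids_above_plane[OF p] card_solids_above_planes[OF p, of s] s L_sub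
      unfolding e by (cases "s = p") auto
  qed
  also have "\<dots> = (if p \<in> L then q^2 + q + 1 else 0) + int (card {s\<in>L. s \<noteq> p \<and> dm (p \<sqinter> s) = 2})"
    using fin_L by (simp add: sum.distrib sum.If_cases Int_def)
  finally show ?thesis using regular[OF p] by (simp add: algebra_simps power2_eq_square power3_eq_cube)
qed

lemma sum_codeg: "(\<Sum>S\<in>F 4. codeg S) = (q^2 + q + 1) * int (card L)"
proof -
  have "(\<Sum>S\<in>F 4. codeg S) = (\<Sum>s\<in>L. int (card {S\<in>F 4. s \<sqsubseteq> S}))"
    unfolding codeg_def by (rule sum_card_swap) (auto simp: fin_F fin_L)
  also have "\<dots> = (\<Sum>s\<in>L. q^2 + q + 1)"
    by (rule sum.cong) (use card_solids_above_plane L_sub in auto)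
  finally show ?thesis by (simp add: mult.commute)
qed

lemma dm_mt_solid_hyperplane:
  assumes S: "S \<in> F 4" and H: "H \<in> F 5" and n: "\<not> S \<sqsubseteq> H"
  shows "S \<sqinter> H \<in> F 3"
proof -
  have X: "S \<in> X" "H \<in> X" using S H F_X by auto
  have "dm (S \<squnion> H) \<ge> 5" using dm_mono[OF X(2) jn_X[OF X] jn_ge2[OF X]] H F_dm by simp
  moreover have "dm (S \<squnion> H) \<noteq> 5"
  proof
    assume "dm (S \<squnion> H) = 5"
    then have "H = S \<squnion> H" using dm_eq[OF X(2) jn_X[OF X] jn_ge2[OF X]] H F_dm by simp
    then show False using n jn_ge1[OF X] by simp
  qed
  ultimately have "dm (S \<squnion> H) = 6" using dm_le[OF jn_X[OF X]] by linarith
  then show ?thesis using modular[OF X] S H mt_X[OF X] by (simp add: F_def)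
qed

lemma planes_below_mt:
  assumes S: "S \<in> F 4" and H: "H \<in> F 5" and n: "\<not> S \<sqsubseteq> H"
  shows "{p\<in>F 3. p \<sqsubseteq> S \<and> p \<sqsubseteq> H} = {S \<sqinter> H}"
proof -
  have X: "S \<in> X" "H \<in> X" using S H F_X by auto
  have m3: "S \<sqinter> H \<in> F 3" by (rule dm_mt_solid_hyperplane[OF assms])
  have "p = S \<sqinter> H" if p: "p \<in> F 3" "p \<sqsubseteq> S" "p \<sqsubseteq> H" for p
    by (rule dm_eq[OF F_X[OF p(1)] mt_X[OF X] mt_greatest[OF X F_X[OF p(1)] p(2,3)]])
      (simp add: F_dm[OF p(1)] F_dm[OF m3])
  then show ?thesis using m3 mt_le1[OF X] mt_le2[OF X] by blast
qed

text \<open>This is the vanishing of the component of \<open>L\<close> in the first non-trivial eigenspace of the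
  Grassmann graph.\<close>

lemma codeg_hyperplane:
  assumes H: "H \<in> F 5"
  shows "(q + 1) * codeg H = x * (q^2 + 1)"
proof -
  let ?P = "{p\<in>F 3. p \<sqsubseteq> H}"
  have "(\<Sum>p\<in>?P. \<Sum>S\<in>{S\<in>F 4. p \<sqsubseteq> S}. codeg S) =
      (\<Sum>p\<in>?P. x + (if p \<in> L then q^2 * (q + 1) else 0))"
    by (rule sum.cong) (use sum_codeg_above_plane in auto)
  also have "\<dots> = int (card ?P) * x + codeg H * (q^2 * (q + 1))"
  proof -
    have "?P \<inter> L = {s\<in>L. s \<sqsubseteq> H}" using L_sub by auto
    then show ?thesis by (simp add: sum.distrib sum.If_cases fin_F codeg_def)
  qed
  finally have 1: "(\<Sum>p\<in>?P. \<Sum>S\<in>{S\<in>F 4. p \<sqsubseteq> S}. codeg S) =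
      int (card ?P) * x + codeg H * (q^2 * (q + 1))" .
  \<comment> \<open>Second evaluation, by solids: a solid in \<open>H\<close> has
    \<open>1 + q * (q^2 + q + 1)\<close> planes in \<open>H\<close>, and any other solid meets
    \<open>H\<close> in a single plane.\<close>
  have "(\<Sum>p\<in>?P. \<Sum>S\<in>{S\<in>F 4. p \<sqsubseteq> S}. codeg S) =
      (\<Sum>S\<in>F 4. codeg S * int (card {p\<in>?P. p \<sqsubseteq> S}))"
    by (rule sum_swap_card) (auto simp: fin_F)
  also have "\<dots> = (\<Sum>S\<in>F 4. codeg S + (q * (q^2 + q + 1)) * (if S \<sqsubseteq> H then codeg S else 0))"
  proof (rule sum.cong[OF refl])
    fix S assume S: "S \<in> F 4"
    have e: "{p\<in>?P. p \<sqsubseteq> S} = {p\<in>F 3. p \<sqsubseteq> S \<and> p \<sqsubseteq> H}" by auto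
    show "codeg S * int (card {p\<in>?P. p \<sqsubseteq> S}) =
        codeg S + (q * (q^2 + q + 1)) * (if S \<sqsubseteq> H then codeg S else 0)"
    proof (cases "S \<sqsubseteq> H")
      case True
      then have "{p\<in>?P. p \<sqsubseteq> S} = {p\<in>F 3. p \<sqsubseteq> S}" using le_trans by blast
      then show ?thesis using card_planes_below_solid[OF S] True
        by (simp add: algebra_simps power2_eq_square)
    next
      case False
      then show ?thesis unfolding e planes_below_mt[OF S H False] by simp
    qed
  qed
  also have "\<dots> = (q^2 + q + 1) * int (card L) +
      (q * (q^2 + q + 1)) * (\<Sum>S\<in>{S\<in>F 4. S \<sqsubseteq> H}. codeg S)"
    using fin_F by (simp add: sum.distrib sum_codeg sum.If_cases Int_def flip: sum_distrib_left)
  also have "(\<Sum>S\<in>{S\<in>F 4. S \<sqsubseteq> H}. codeg S) = (q + 1) * codeg H"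
  proof -
    have "(\<Sum>S\<in>{S\<in>F 4. S \<sqsubseteq> H}. codeg S) = (\<Sum>s\<in>L. int (card {S\<in>{S\<in>F 4. S \<sqsubseteq> H}. s \<sqsubseteq> S}))"
      unfolding codeg_def by (rule sum_card_swap) (auto simp: fin_F fin_L)
    also have "\<dots> = (\<Sum>s\<in>L. if s \<sqsubseteq> H then q + 1 else 0)"
    proof (rule sum.cong[OF refl])
      fix s assume s: "s \<in> L"
      have e: "{S\<in>{S\<in>F 4. S \<sqsubseteq> H}. s \<sqsubseteq> S} = {S\<in>F 4. s \<sqsubseteq> S \<and> S \<sqsubseteq> H}" by auto
      show "int (card {S\<in>{S\<in>F 4. S \<sqsubseteq> H}. s \<sqsubseteq> S}) = (if s \<sqsubseteq> H then q + 1 else 0)"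
      proof (cases "s \<sqsubseteq> H")
        case True
        then show ?thesis unfolding e using card_solids_between_plane_hyperplane H s L_sub by auto
      next
        case False
        then have e': "{S\<in>F 4. s \<sqsubseteq> S \<and> S \<sqsubseteq> H} = {}" using le_trans by blast
        show ?thesis unfolding e e' using False by simp
      qed
    qed
    also have "\<dots> = (q + 1) * codeg H"
      using fin_L by (simp add: sum.If_cases codeg_def Int_def mult.commute)
    finally show ?thesis .
  qed
  finally have 2: "int (card ?P) * x + codeg H * (q^2 * (q + 1)) =
    (q^2 + q + 1) * int (card L) + (q * (q^2 + q + 1)) * ((q + 1) * codeg H)"
    using 1 by simp
  \<comment> \<open>A linear equation for \<open>codeg H\<close>; it simplifies because
    \<open>(q^2 + q + 1) * (q^2 - q + 1)\<close> equals \<open>q^4 + q^2 + 1\<close>.\<close>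
  have "(q * (q^2 + 1)) * ((q + 1) * codeg H) = (q * (q^2 + 1)) * (x * (q^2 + 1))"
    using 2 unfolding card_planes_below_hyperplane[OF H] card_L by algebra
  moreover have "q * (q^2 + 1) \<noteq> 0" using q_ge by (auto simp: add_nonneg_eq_0_iff)
  ultimately show ?thesis by simp
qed

text \<open>The weight of \<open>S\<close> as a line of the quotient at \<open>l\<close>. If
  \<open>S\<close> contains \<open>l\<close>, the planes counted meet \<open>l\<close> in exactly
  one point.\<close>

definition spans :: "'b \<Rightarrow> 'b \<Rightarrow> int" where
  "spans l S = int (card {s\<in>L. s \<sqsubseteq> S \<and> \<not> l \<sqsubseteq> s})"

text \<open>The weight is \<open>codeg S\<close> minus the number of points of the line in
  \<open>T\<close>, so the sum over a pencil is the difference of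
  \<open>sum_codeg_above_plane\<close> and \<open>sum_k_pencil\<close>.\<close>

lemma quotient_weighted_linear_space:
  assumes l: "l \<in> F 2"
  shows "weighted_linear_space q {p\<in>F 3. l \<sqsubseteq> p} {p\<in>L. l \<sqsubseteq> p} {S\<in>F 4. l \<sqsubseteq> S} (\<sqsubseteq>) x (spans l)"
    and "linear_space.n {p\<in>L. l \<sqsubseteq> p} = deg l"
    and "spans l S + linear_space.k {p\<in>L. l \<sqsubseteq> p} (\<sqsubseteq>) S = codeg S"
proof -
  interpret A: linear_space q "{p\<in>F 3. l \<sqsubseteq> p}" "{p\<in>L. l \<sqsubseteq> p}" "{S\<in>F 4. l \<sqsubseteq> S}" "(\<sqsubseteq>)"
    by (rule quotient_linear_space[OF l L_sub])
  show n: "A.n = deg l" by (simp add: A.n_def deg_def)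
  show sk: "spans l S + A.k S = codeg S" for S
  proof -
    have "card {s\<in>L. s \<sqsubseteq> S \<and> \<not> l \<sqsubseteq> s} + card {s\<in>{p\<in>L. l \<sqsubseteq> p}. s \<sqsubseteq> S} =
        card ({s\<in>L. s \<sqsubseteq> S \<and> \<not> l \<sqsubseteq> s} \<union> {s\<in>{p\<in>L. l \<sqsubseteq> p}. s \<sqsubseteq> S})"
      by (rule card_Un_disjoint[symmetric]) (auto simp: fin_L)
    also have "{s\<in>L. s \<sqsubseteq> S \<and> \<not> l \<sqsubseteq> s} \<union> {s\<in>{p\<in>L. l \<sqsubseteq> p}. s \<sqsubseteq> S} = {s\<in>L. s \<sqsubseteq> S}" by auto
    finally show ?thesis by (simp add: spans_def A.k_def codeg_def)
  qed
  show "weighted_linear_space q {p\<in>F 3. l \<sqsubseteq> p} {p\<in>L. l \<sqsubseteq> p} {S\<in>F 4. l \<sqsubseteq> S} (\<sqsubseteq>) x (spans l)"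
  proof
    show "0 \<le> spans l S" for S by (simp add: spans_def)
    fix p assume p: "p \<in> {p\<in>F 3. l \<sqsubseteq> p}"
    have e: "{S\<in>{S\<in>F 4. l \<sqsubseteq> S}. p \<sqsubseteq> S} = {S\<in>F 4. p \<sqsubseteq> S}" using p le_trans by blast
    have "spans l S = codeg S - A.k S" for S using sk[of S] by simp
    then have "(\<Sum>S\<in>{S\<in>{S\<in>F 4. l \<sqsubseteq> S}. p \<sqsubseteq> S}. spans l S) =
      (\<Sum>S\<in>{S\<in>F 4. p \<sqsubseteq> S}. codeg S) - (\<Sum>S\<in>{S\<in>{S\<in>F 4. l \<sqsubseteq> S}. p \<sqsubseteq> S}. A.k S)"
      unfolding e by (simp add: sum_subtractf)
    also have "\<dots> = x - A.n + (if p \<in> {p\<in>L. l \<sqsubseteq> p} then q^3 - q else 0)"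
      using p unfolding A.sum_k_pencil[OF p]
      by (simp add: sum_codeg_above_plane algebra_simps power2_eq_square power3_eq_cube)
    finally show "(\<Sum>S\<in>{S\<in>{S\<in>F 4. l \<sqsubseteq> S}. p \<sqsubseteq> S}. spans l S) =
        x - A.n + (if p \<in> {p\<in>L. l \<sqsubseteq> p} then q^3 - q else 0)" .
  qed
qed

text \<open>Two distinct solids on \<open>s\<close> meet exactly in \<open>s\<close>, so
  \<open>l\<close> cannot lie in both.\<close>

lemma card_solids_above_line_plane_le:
  assumes l: "l \<in> F 2" and s: "s \<in> F 3" "\<not> l \<sqsubseteq> s"
  shows "card {S\<in>F 4. l \<sqsubseteq> S \<and> s \<sqsubseteq> S} \<le> 1"
proof -
  have "S = S'" if S: "S \<in> F 4" "l \<sqsubseteq> S" "s \<sqsubseteq> S" "S' \<in> F 4" "l \<sqsubseteq> S'" "s \<sqsubseteq> S'" for S S'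
  proof (rule ccontr)
    assume ne: "S \<noteq> S'"
    have X: "S \<in> X" "S' \<in> X" "s \<in> X" "l \<in> X" using S l s F_X by auto
    have sm: "s \<sqsubseteq> S \<sqinter> S'" by (rule mt_greatest[OF X(1,2,3) S(3,6)])
    have "dm s = dm (S \<sqinter> S')"
      using dm_mono[OF X(3) mt_X[OF X(1,2)] sm] dm_mt_less[OF S(1,4) ne] F_dm[OF s(1)] by linarith
    then have "s = S \<sqinter> S'" by (rule dm_eq[OF X(3) mt_X[OF X(1,2)] sm])
    moreover have "l \<sqsubseteq> S \<sqinter> S'" by (rule mt_greatest[OF X(1,2,4) S(2,5)])
    ultimately show False using s(2) by simp
  qed
  moreover have "finite {S\<in>F 4. l \<sqsubseteq> S \<and> s \<sqsubseteq> S}" using fin_F by simp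
  ultimately show ?thesis unfolding One_nat_def by (subst card_le_Suc0_iff_eq) auto
qed

text \<open>\<open>H\<close> is a plane of the quotient at \<open>l\<close>. Adding the pencil sums
  over its points determines the total weight \<open>c\<close> of its lines. Since \<open>c\<close>
  counts distinct planes of \<open>L\<close> in \<open>H\<close> off \<open>l\<close>, the known
  value of \<open>codeg H\<close> limits the number on \<open>l\<close>.\<close>

lemma card_between_line_hyperplane_le:
  assumes l: "l \<in> F 2" and H: "H \<in> F 5" and lH: "l \<sqsubseteq> H"
    and x: "x \<le> (q + 1)^2" "deg l \<le> x"
  shows "int (card {s\<in>L. l \<sqsubseteq> s \<and> s \<sqsubseteq> H}) \<le> 2 * q + 2"
proof -
  interpret A: weighted_linear_space q "{p\<in>F 3. l \<sqsubseteq> p}" "{p\<in>L. l \<sqsubseteq> p}" "{S\<in>F 4. l \<sqsubseteq> S}" "(\<sqsubseteq>)" x "spans l"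
    by (rule quotient_weighted_linear_space[OF l])
  have n: "A.n = deg l" by (rule quotient_weighted_linear_space[OF l])
  let ?kH = "int (card {s\<in>L. l \<sqsubseteq> s \<and> s \<sqsubseteq> H})"
  let ?S = "{S\<in>F 4. l \<sqsubseteq> S \<and> S \<sqsubseteq> H}"
  define c where "c = (\<Sum>S\<in>?S. spans l S)"
  have "c = (\<Sum>S\<in>?S. int (card {s\<in>{s\<in>L. \<not> l \<sqsubseteq> s}. s \<sqsubseteq> S}))"
    unfolding c_def spans_def by (rule sum.cong) (auto intro!: arg_cong[where f = card])
  also have "\<dots> = (\<Sum>s\<in>{s\<in>L. \<not> l \<sqsubseteq> s}. int (card {S\<in>?S. s \<sqsubseteq> S}))"
    by (rule sum_card_swap) (auto simp: fin_F fin_L)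
  also have "\<dots> \<le> (\<Sum>s\<in>{s\<in>L. \<not> l \<sqsubseteq> s}. if s \<sqsubseteq> H then 1 else 0)"
  proof (rule sum_mono)
    fix s assume s: "s \<in> {s\<in>L. \<not> l \<sqsubseteq> s}"
    show "int (card {S\<in>?S. s \<sqsubseteq> S}) \<le> (if s \<sqsubseteq> H then 1 else 0)"
    proof (cases "s \<sqsubseteq> H")
      case True
      have "card {S\<in>?S. s \<sqsubseteq> S} \<le> card {S\<in>F 4. l \<sqsubseteq> S \<and> s \<sqsubseteq> S}"
        by (rule card_mono) (auto simp: fin_F)
      then show ?thesis using True card_solids_above_line_plane_le[OF l, of s] s L_sub by auto
    next
      case False
      then have e: "{S\<in>?S. s \<sqsubseteq> S} = {}" using le_trans by blast
      show ?thesis unfolding e using False by simp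
    qed
  qed
  also have "\<dots> = int (card {s\<in>L. \<not> l \<sqsubseteq> s \<and> s \<sqsubseteq> H})"
    using fin_L by (simp add: sum.If_cases Int_def conj_assoc)
  finally have "?kH + c \<le> ?kH + int (card {s\<in>L. \<not> l \<sqsubseteq> s \<and> s \<sqsubseteq> H})" by simp
  also have "\<dots> = int (card ({s\<in>L. l \<sqsubseteq> s \<and> s \<sqsubseteq> H} \<union> {s\<in>L. \<not> l \<sqsubseteq> s \<and> s \<sqsubseteq> H}))"
    by (subst card_Un_disjoint) (auto simp: fin_L)
  also have "{s\<in>L. l \<sqsubseteq> s \<and> s \<sqsubseteq> H} \<union> {s\<in>L. \<not> l \<sqsubseteq> s \<and> s \<sqsubseteq> H} = {s\<in>L. s \<sqsubseteq> H}" by auto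
  finally have 1: "?kH + c \<le> codeg H" by (simp add: codeg_def)
  let ?P = "{p\<in>F 3. l \<sqsubseteq> p \<and> p \<sqsubseteq> H}"
  have "(\<Sum>p\<in>?P. \<Sum>S\<in>{S\<in>{S\<in>F 4. l \<sqsubseteq> S}. p \<sqsubseteq> S}. spans l S) =
      (\<Sum>S\<in>{S\<in>F 4. l \<sqsubseteq> S}. spans l S * int (card {p\<in>?P. p \<sqsubseteq> S}))"
    by (rule sum_swap_card) (auto simp: fin_F)
  \<comment> \<open>A line of the quotient has all its \<open>q + 1\<close> points in the plane
    given by \<open>H\<close>, or just one.\<close>
  also have "\<dots> = (\<Sum>S\<in>{S\<in>F 4. l \<sqsubseteq> S}. spans l S + q * (if S \<sqsubseteq> H then spans l S else 0))"
  proof (rule sum.cong[OF refl])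
    fix S assume S: "S \<in> {S\<in>F 4. l \<sqsubseteq> S}"
    show "spans l S * int (card {p\<in>?P. p \<sqsubseteq> S}) =
        spans l S + q * (if S \<sqsubseteq> H then spans l S else 0)"
    proof (cases "S \<sqsubseteq> H")
      case True
      then have "{p\<in>?P. p \<sqsubseteq> S} = {p\<in>F 3. l \<sqsubseteq> p \<and> p \<sqsubseteq> S}" using le_trans by blast
      then show ?thesis using card_planes_between_line_solid[OF l, of S] True S
        by (simp add: algebra_simps)
    next
      case False
      have S4: "S \<in> F 4" using S by simp
      have X: "S \<in> X" "H \<in> X" "l \<in> X" using S4 H l F_X by auto
      have "l \<sqsubseteq> S \<sqinter> H" by (rule mt_greatest) (use X S lH in auto)
      then have "{p\<in>?P. p \<sqsubseteq> S} = {S \<sqinter> H}" using planes_below_mt[OF S4 H False] by blast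
      then show ?thesis using False by simp
    qed
  qed
  also have "\<dots> = (x * (q^2 + 1) - (q + 1) * deg l) + q * c"
    using fin_F by (simp add: sum.distrib A.sum_w[unfolded n] c_def sum.If_cases Int_def conj_assoc
        flip: sum_distrib_left)
  finally have 2: "(\<Sum>p\<in>?P. \<Sum>S\<in>{S\<in>{S\<in>F 4. l \<sqsubseteq> S}. p \<sqsubseteq> S}. spans l S) =
     (x * (q^2 + 1) - (q + 1) * deg l) + q * c" .
  have "(\<Sum>p\<in>?P. \<Sum>S\<in>{S\<in>{S\<in>F 4. l \<sqsubseteq> S}. p \<sqsubseteq> S}. spans l S) =
      (\<Sum>p\<in>?P. (x - deg l) + (if p \<in> L then q^3 - q else 0))"
    by (rule sum.cong) (use A.w_pencil n in auto)
  also have "\<dots> = (q^2 + q + 1) * (x - deg l) + ?kH * (q^3 - q)"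
  proof -
    have "?P \<inter> L = {s\<in>L. l \<sqsubseteq> s \<and> s \<sqsubseteq> H}" using L_sub by auto
    then show ?thesis
      using card_planes_between_line_hyperplane[OF l H lH] fin_F
      by (simp add: sum.distrib sum.If_cases)
  qed
  finally have "q * c = (q^2 + q + 1) * (x - deg l) + ?kH * (q^3 - q)
      - (x * (q^2 + 1) - (q + 1) * deg l)" using 2 by simp
  also have "\<dots> = q * (x - q * deg l + (q^2 - 1) * ?kH)" by algebra
  finally have "c = x - q * deg l + (q^2 - 1) * ?kH" using q_ge by simp
  then have "q^2 * ?kH \<le> codeg H - x + q * deg l" using 1 by (simp add: algebra_simps)
  \<comment> \<open>The factor \<open>q + 1\<close> makes \<open>codeg_hyperplane\<close>
    applicable.\<close>
  then have "(q + 1) * (q^2 * ?kH) \<le> (q + 1) * (codeg H - x + q * deg l)"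
    using q_ge by (intro mult_left_mono) auto
  also have "\<dots> = (q * (q - 1)) * x + (q * (q + 1)) * deg l"
    using codeg_hyperplane[OF H] by algebra
  also have "\<dots> \<le> (q * (q - 1)) * (q + 1)^2 + (q * (q + 1)) * (q + 1)^2"
    using x q_ge by (intro add_mono mult_left_mono) auto
  also have "\<dots> = (q + 1) * (q^2 * (2 * (q + 1)))" by algebra
  finally show ?thesis using q_ge by simp
qed

text \<open>Weight plus \<open>k\<close> is \<open>codeg S\<close>, so \<open>max\<close> provides
  the hypothesis of the range lemmas. It remains to see that a solid whose planes on
  \<open>l\<close> are all in \<open>L\<close> meets at most \<open>q + 1\<close> others of this
  kind in a plane of \<open>L\<close> on \<open>l\<close>.\<close>

lemma deg_le:
  assumes l: "l \<in> F 2" and nonfull: "\<exists>p\<in>F 3. l \<sqsubseteq> p \<and> p \<notin> L" and x: "x \<le> (q + 1)^2"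
    and max: "\<And>S. S \<in> F 4 \<Longrightarrow> codeg S \<le> deg l"
  shows "deg l \<le> q + 1" and "x < (q + 1)^2 \<Longrightarrow> deg l \<le> q"
proof -
  interpret A: weighted_linear_space q "{p\<in>F 3. l \<sqsubseteq> p}" "{p\<in>L. l \<sqsubseteq> p}" "{S\<in>F 4. l \<sqsubseteq> S}" "(\<sqsubseteq>)" x "spans l"
    by (rule quotient_weighted_linear_space[OF l])
  have n: "A.n = deg l" and sk: "spans l S + A.k S = codeg S" for S
    by (rule quotient_weighted_linear_space[OF l])+
  have "{p\<in>L. l \<sqsubseteq> p} \<noteq> {p\<in>F 3. l \<sqsubseteq> p}" using nonfull by auto
  then have nx: "A.n \<le> x" by (rule A.n_le_x)
  have max': "spans l S + A.k S \<le> A.n" if "S \<in> {S\<in>F 4. l \<sqsubseteq> S}" for S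
    using max[of S] that unfolding sk n by simp
  have "A.n \<le> q^2 - 2 * q"
  proof (rule A.not_upper_range[OF x nx max'])
    fix S assume S: "S \<in> A.full_lines"
    let ?M = "{S'\<in>A.full_lines. S' \<noteq> S \<and> (\<exists>p\<in>{p\<in>L. l \<sqsubseteq> p}. p \<sqsubseteq> S \<and> p \<sqsubseteq> S')}"
    have SF: "S \<in> F 4" "l \<sqsubseteq> S" using S by (auto simp: A.full_lines_def)
    have M: "S' \<in> F 4 \<and> l \<sqsubseteq> S' \<and> A.k S' = q + 1 \<and> S' \<noteq> S" if "S' \<in> ?M" for S'
      using that by (auto simp: A.full_lines_def)
    \<comment> \<open>Such a solid spans with \<open>S\<close> one of the \<open>q + 1\<close>
      hyperplanes on \<open>S\<close>.\<close>
    have into: "(\<squnion>) S ` ?M \<subseteq> {H\<in>F 5. S \<sqsubseteq> H}"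
    proof
      fix H assume "H \<in> (\<squnion>) S ` ?M"
      then obtain S' p where S': "S' \<in> ?M" "H = S \<squnion> S'" and p: "p \<in> L" "p \<sqsubseteq> S" "p \<sqsubseteq> S'"
        by auto
      have p3: "p \<in> F 3" using p L_sub by auto
      have X: "S \<in> X" "S' \<in> X" "p \<in> X" using SF M[OF S'(1)] p3 F_X by blast+
      have "dm (S \<sqinter> S') < 4" by (rule dm_mt_less) (use SF(1) M[OF S'(1)] in blast)+
      moreover have "dm (S \<sqinter> S') \<ge> 3"
        using dm_mono[OF X(3) mt_X[OF X(1,2)] mt_greatest[OF X p(2,3)]] p3 F_dm by simp
      ultimately have "dm (S \<sqinter> S') = 3" by linarith
      then have "dm (S \<squnion> S') = 5" using modular[OF X(1,2)] SF M[OF S'(1)] F_dm by simp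
      then show "H \<in> {H\<in>F 5. S \<sqsubseteq> H}" using jn_X[OF X(1,2)] jn_ge1[OF X(1,2)] S' by (simp add: F_def)
    qed
    \<comment> \<open>Three such solids in one hyperplane would hold at least
      \<open>3 * (q + 1) - 3\<close> planes of \<open>L\<close> on \<open>l\<close>, as any two
      share at most one. This exceeds \<open>2 * q + 2\<close>.\<close>
    have "inj_on ((\<squnion>) S) ?M"
    proof (rule inj_onI, rule ccontr)
      fix S1 S2 assume S12: "S1 \<in> ?M" "S2 \<in> ?M" "S \<squnion> S1 = S \<squnion> S2" "S1 \<noteq> S2"
      define H where "H = S \<squnion> S1"
      have X: "S \<in> X" "S1 \<in> X" "S2 \<in> X" using SF M[OF S12(1)] M[OF S12(2)] F_X by auto
      have le: "S \<sqsubseteq> H" "S1 \<sqsubseteq> H" "S2 \<sqsubseteq> H"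
        using jn_ge1[OF X(1,2)] jn_ge2[OF X(1,2)] jn_ge2[OF X(1,3)] S12(3) by (auto simp: H_def)
      have H: "H \<in> F 5" using into S12(1) by (auto simp: H_def)
      define T where "T S = {p\<in>{p\<in>L. l \<sqsubseteq> p}. p \<sqsubseteq> S}" for S
      have fT: "finite (T S)" for S by (simp add: T_def fin_L)
      have cT: "int (card (T S)) = q + 1" "int (card (T S1)) = q + 1" "int (card (T S2)) = q + 1"
        using S M[OF S12(1)] M[OF S12(2)] by (auto simp: T_def A.k_def A.full_lines_def)
      have int1: "card (T U \<inter> T V) \<le> 1"
        if UV: "U \<in> F 4" "l \<sqsubseteq> U" "V \<in> F 4" "l \<sqsubseteq> V" "U \<noteq> V" for U V
      proof -
        have "p = p'" if "p \<in> T U \<inter> T V" "p' \<in> T U \<inter> T V" for p p'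
        proof (rule ccontr)
          assume "p \<noteq> p'"
          then have "card {S\<in>{S\<in>F 4. l \<sqsubseteq> S}. p \<sqsubseteq> S \<and> p' \<sqsubseteq> S} = 1"
            using that L_sub by (intro A.join) (auto simp: T_def)
          then obtain Z where Z: "{S\<in>{S\<in>F 4. l \<sqsubseteq> S}. p \<sqsubseteq> S \<and> p' \<sqsubseteq> S} = {Z}"
            by (rule card_1_singletonE)
          have "U \<in> {Z}" "V \<in> {Z}" unfolding Z[symmetric] using that UV by (auto simp: T_def)
          then show False using UV by simp
        qed
        moreover have "finite (T U \<inter> T V)" using fT by simp
        ultimately show ?thesis unfolding One_nat_def by (subst card_le_Suc0_iff_eq) auto
      qed
      have "T S \<union> T S1 \<union> T S2 \<subseteq> {s\<in>L. l \<sqsubseteq> s \<and> s \<sqsubseteq> H}"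
        using le le_trans by (auto simp: T_def)
      then have "card (T S \<union> T S1 \<union> T S2) \<le> card {s\<in>L. l \<sqsubseteq> s \<and> s \<sqsubseteq> H}"
        by (intro card_mono) (auto simp: fin_L)
      moreover have "l \<sqsubseteq> H" using SF(2) le(1) le_trans by blast
      ultimately have up: "int (card (T S \<union> T S1 \<union> T S2)) \<le> 2 * q + 2"
        using card_between_line_hyperplane_le[OF l H _ x] nx n by fastforce
      have "card (T S) + card (T S1) = card (T S \<union> T S1) + card (T S \<inter> T S1)"
        by (rule card_Un_Int[OF fT fT])
      moreover have "card (T S \<union> T S1) + card (T S2) =
          card (T S \<union> T S1 \<union> T S2) + card ((T S \<union> T S1) \<inter> T S2)"
        using fT by (intro card_Un_Int) auto
      moreover have "card ((T S \<union> T S1) \<inter> T S2) \<le> card (T S \<inter> T S2) + card (T S1 \<inter> T S2)"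
        by (simp add: Int_Un_distrib2 card_Un_le)
      moreover have "card (T S \<inter> T S1) \<le> 1" "card (T S \<inter> T S2) \<le> 1" "card (T S1 \<inter> T S2) \<le> 1"
        using int1[of S S1] int1[of S S2] int1[of S1 S2] SF M[OF S12(1)] M[OF S12(2)] S12(4) by auto
      ultimately have "3 * q \<le> int (card (T S \<union> T S1 \<union> T S2))" using cT by linarith
      then show False using up q_ge by linarith
    qed
    then have "card ?M = card ((\<squnion>) S ` ?M)" by (simp add: card_image)
    also have "\<dots> \<le> card {H\<in>F 5. S \<sqsubseteq> H}" by (rule card_mono[OF _ into]) (simp add: fin_F)
    finally show "int (card ?M) \<le> q + 1" using card_hyperplanes_above_solid[OF SF(1)] by simp
  qed
  then have 1: "A.n \<le> q + 1" using A.not_mid_range[OF x max'] by simp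
  then show "deg l \<le> q + 1" unfolding n .
  show "deg l \<le> q" if "x < (q + 1)^2"
    using A.n_ne_Suc_q[OF that max'] 1 unfolding n by simp
qed

text \<open>In the case of equality all weights at \<open>l\<close> vanish. A plane of
  \<open>L\<close> meeting \<open>l\<close> in just a point would span a solid with \<open>l\<close>
  and give it positive weight.\<close>

lemma full_line:
  assumes l: "l \<in> F 2" and full: "\<And>p. p \<in> F 3 \<Longrightarrow> l \<sqsubseteq> p \<Longrightarrow> p \<in> L"
  shows "(q + 1)^2 \<le> x"
    and "\<lbrakk>x = (q + 1)^2; s \<in> L; \<not> l \<sqsubseteq> s\<rbrakk> \<Longrightarrow> dm (s \<sqinter> l) = 0"
proof -
  interpret A: weighted_linear_space q "{p\<in>F 3. l \<sqsubseteq> p}" "{p\<in>L. l \<sqsubseteq> p}" "{S\<in>F 4. l \<sqsubseteq> S}" "(\<sqsubseteq>)" x "spans l"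
    by (rule quotient_weighted_linear_space[OF l])
  have T: "{p\<in>L. l \<sqsubseteq> p} = {p\<in>F 3. l \<sqsubseteq> p}" using full L_sub by auto
  show "(q + 1)^2 \<le> x" by (rule A.x_ge_of_full[OF T])
  assume x: "x = (q + 1)^2" and s: "s \<in> L" "\<not> l \<sqsubseteq> s"
  have X: "s \<in> X" "l \<in> X" using s L_sub l F_X by auto
  have ds: "dm s = 3" "dm l = 2" using s L_sub l F_dm by auto
  show "dm (s \<sqinter> l) = 0"
  proof (rule ccontr)
    assume "dm (s \<sqinter> l) \<noteq> 0"
    moreover have "dm (s \<sqinter> l) \<le> 2"
      using dm_mono[OF mt_X[OF X] X(2) mt_le2[OF X]] ds by simp
    moreover have "dm (s \<sqinter> l) \<noteq> 2"
    proof
      assume "dm (s \<sqinter> l) = 2"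
      then have "s \<sqinter> l = l" using dm_eq[OF mt_X[OF X] X(2) mt_le2[OF X]] ds by simp
      then show False using mt_le1[OF X] s by simp
    qed
    ultimately have "dm (s \<sqinter> l) = 1" by linarith
    then have "dm (s \<squnion> l) = 4" using modular[OF X] ds by simp
    then have "s \<squnion> l \<in> {S\<in>F 4. l \<sqsubseteq> S}" using jn_X[OF X] jn_ge2[OF X] by (simp add: F_def)
    then have "spans l (s \<squnion> l) = 0" by (rule A.x_ge_of_full(2)[OF T x])
    moreover have "s \<in> {t\<in>L. t \<sqsubseteq> s \<squnion> l \<and> \<not> l \<sqsubseteq> t}" using s jn_ge1[OF X] by simp
    ultimately show False using fin_L by (auto simp: spans_def card_eq_0_iff)
  qed
qed

lemma deg_le_x:
  assumes l: "l \<in> F 2" and nonfull: "\<exists>p\<in>F 3. l \<sqsubseteq> p \<and> p \<notin> L"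
  shows "deg l \<le> x" and "\<lbrakk>0 < deg l; deg l \<le> q\<rbrakk> \<Longrightarrow> deg l \<noteq> x"
proof -
  interpret A: weighted_linear_space q "{p\<in>F 3. l \<sqsubseteq> p}" "{p\<in>L. l \<sqsubseteq> p}" "{S\<in>F 4. l \<sqsubseteq> S}" "(\<sqsubseteq>)" x "spans l"
    by (rule quotient_weighted_linear_space[OF l])
  have n: "A.n = deg l" by (rule quotient_weighted_linear_space[OF l])
  have "{p\<in>L. l \<sqsubseteq> p} \<noteq> {p\<in>F 3. l \<sqsubseteq> p}" using nonfull by auto
  then show "deg l \<le> x" using A.n_le_x n by simp
  show "\<lbrakk>0 < deg l; deg l \<le> q\<rbrakk> \<Longrightarrow> deg l \<noteq> x" using A.n_small_ne_x n by simp
qed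

text \<open>For \<open>x = (q + 1)^2\<close> the solids on a plane of \<open>L\<close> have mean
  \<open>codeg\<close> exactly \<open>q + 1\<close>, so an upper bound of \<open>q + 1\<close> is
  attained by all of them.\<close>

lemma codeg_eq_of_le:
  assumes x: "x = (q + 1)^2" and le: "\<And>S. S \<in> F 4 \<Longrightarrow> codeg S \<le> q + 1" and S: "S \<in> F 4"
  shows "codeg S = 0 \<or> codeg S = q + 1"
proof (cases "codeg S = 0")
  case False
  then obtain p where p: "p \<in> L" "p \<sqsubseteq> S" using fin_L by (auto simp: codeg_def card_eq_0_iff)
  then have p3: "p \<in> F 3" using L_sub by auto
  let ?A = "{S\<in>F 4. p \<sqsubseteq> S}"
  have "(\<Sum>S\<in>?A. q + 1 - codeg S) =
      (q + 1) * int (card ?A) - (\<Sum>S\<in>?A. codeg S)"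
    by (simp add: sum_subtractf)
  also have "\<dots> = (q + 1) * (q^2 + q + 1) - (x + q^2 * (q + 1))"
    using card_solids_above_plane[OF p3] sum_codeg_above_plane[OF p3] p by simp
  also have "\<dots> = 0" unfolding x by algebra
  finally have "\<forall>S\<in>?A. q + 1 - codeg S = 0"
    using le by (subst (asm) sum_nonneg_eq_0_iff) (auto simp: fin_F)
  then show ?thesis using S p by auto
qed simp

text \<open>A line or solid with all its planes in \<open>L\<close> is treated by
  \<open>full_line\<close>, in the lattice or its dual. Otherwise \<open>deg_le\<close> bounds all
  degrees, and averages over the lines or solids incident with a plane of \<open>L\<close> give the
  claims.\<close>

theorem regular_planes_bound:
  assumes ne: "L \<noteq> {}"
  shows "(q + 1)^2 \<le> x"
    and "x = (q + 1)^2 \<Longrightarrow>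
      (\<exists>S\<in>F 4. (\<forall>p\<in>F 3. p \<sqsubseteq> S \<longrightarrow> p \<in> L) \<and> (\<forall>p\<in>L. p \<sqsubseteq> S \<or> dm (p \<sqinter> S) = 1)) \<or>
      (\<exists>l\<in>F 2. (\<forall>p\<in>F 3. l \<sqsubseteq> p \<longrightarrow> p \<in> L) \<and> (\<forall>p\<in>L. l \<sqsubseteq> p \<or> dm (p \<sqinter> l) = 0)) \<or>
      (\<forall>l\<in>F 2. deg l \<in> {0, q + 1}) \<and> (\<forall>S\<in>F 4. codeg S \<in> {0, q + 1})"
proof -
  interpret D: regular_planes q X "\<lambda>a b. b \<sqsubseteq> a" "\<lambda>a. 6 - dm a" "(\<squnion>)" "(\<sqinter>)" L x
    by (rule dual_regular)
  have DF: "D.F 2 = F 4" "D.F 3 = F 3" "D.F 4 = F 2"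
    using dual_F[of 2] dual_F[of 3] dual_F[of 4] by simp_all
  have Ddeg: "D.deg = codeg" "D.codeg = deg"
    by (auto simp: D.deg_def codeg_def D.codeg_def deg_def)
  define fl where "fl \<longleftrightarrow> (\<exists>l\<in>F 2. \<forall>p\<in>F 3. l \<sqsubseteq> p \<longrightarrow> p \<in> L)"
  define fs where "fs \<longleftrightarrow> (\<exists>S\<in>F 4. \<forall>p\<in>F 3. p \<sqsubseteq> S \<longrightarrow> p \<in> L)"
  have degs: "(\<forall>l\<in>F 2. deg l \<le> q + 1) \<and> (\<forall>S\<in>F 4. codeg S \<le> q + 1) \<and>
      (x < (q + 1)^2 \<longrightarrow> (\<forall>l\<in>F 2. deg l \<le> q))"
    if nf: "\<not> fl" "\<not> fs" and x: "x \<le> (q + 1)^2"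
  proof -
    \<comment> \<open>The maximum is taken over lines and solids together: if a line attains it,
      \<open>deg_le\<close> applies directly, and if a solid does, its dual applies.\<close>
    define m where "m = Max (deg ` F 2 \<union> codeg ` F 4)"
    have fin: "finite (deg ` F 2 \<union> codeg ` F 4)" using fin_F by simp
    have nonempty: "deg ` F 2 \<union> codeg ` F 4 \<noteq> {}"
    proof -
      obtain p where p: "p \<in> F 3" using ne L_sub by auto
      then have "int (card {S\<in>F 4. p \<sqsubseteq> S}) \<noteq> 0"
        using card_solids_above_plane q_ge by (simp add: add_nonneg_eq_0_iff)
      then have "F 4 \<noteq> {}" by auto
      then show ?thesis by simp
    qed
    have le: "deg l \<le> m" if "l \<in> F 2" for l unfolding m_def using fin that by (intro Max_ge) auto
    have cole: "codeg S \<le> m" if "S \<in> F 4" for S unfolding m_def using fin that by (intro Max_ge) auto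
    have "m \<le> q + 1 \<and> (x < (q + 1)^2 \<longrightarrow> m \<le> q)"
      using Max_in[OF fin nonempty] unfolding m_def[symmetric]
    proof
      assume "m \<in> deg ` F 2"
      then obtain l where l: "l \<in> F 2" "m = deg l" by auto
      have "\<exists>p\<in>F 3. l \<sqsubseteq> p \<and> p \<notin> L" using nf l by (auto simp: fl_def)
      have "codeg S \<le> deg l" if "S \<in> F 4" for S using cole[OF that] l(2) by simp
      then show ?thesis using deg_le[OF l(1) \<open>\<exists>p\<in>F 3. l \<sqsubseteq> p \<and> p \<notin> L\<close> x] l(2) by simp
    next
      assume "m \<in> codeg ` F 4"
      then obtain S where S: "S \<in> F 4" "m = codeg S" by auto
      have "\<exists>p\<in>F 3. p \<sqsubseteq> S \<and> p \<notin> L" using nf S by (auto simp: fs_def)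
      have "deg l \<le> codeg S" if "l \<in> F 2" for l using le[OF that] S(2) by simp
      then show ?thesis
        using D.deg_le[of S, unfolded DF Ddeg, OF S(1) \<open>\<exists>p\<in>F 3. p \<sqsubseteq> S \<and> p \<notin> L\<close> x] S(2) by simp
    qed
    then show ?thesis using le cole by fastforce
  qed
  show bound: "(q + 1)^2 \<le> x"
  proof (rule ccontr)
    assume "\<not> ?thesis"
    then have x: "x < (q + 1)^2" by simp
    have nf: "\<not> fl" "\<not> fs"
    proof -
      show "\<not> fl"
      proof
        assume fl
        then obtain l where "l \<in> F 2" "\<forall>p\<in>F 3. l \<sqsubseteq> p \<longrightarrow> p \<in> L" by (auto simp: fl_def)
        then have "(q + 1)^2 \<le> x" by (intro full_line(1)) blast+
        then show False using x by simp
      qed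
      show "\<not> fs"
      proof
        assume fs
        then obtain S where "S \<in> F 4" "\<forall>p\<in>F 3. p \<sqsubseteq> S \<longrightarrow> p \<in> L" by (auto simp: fs_def)
        then have "(q + 1)^2 \<le> x" by (intro D.full_line(1)[unfolded DF]) blast+
        then show False using x by simp
      qed
    qed
    obtain p where p: "p \<in> L" "p \<in> F 3" using ne L_sub by auto
    \<comment> \<open>On these lines \<open>deg l \<le> x\<close> forces \<open>q \<le> x\<close>,
      and \<open>deg l \<le> q\<close> forces \<open>x \<le> q\<close>. But then no degree equals
      \<open>x = q\<close>, and degrees of at most \<open>q - 1\<close> cannot reach the required
      sum.\<close>
    let ?A = "{l\<in>F 2. l \<sqsubseteq> p}"
    have sum: "(\<Sum>l\<in>?A. deg l) = x + q^2 * (q + 1)"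
      using D.sum_codeg_above_plane[of p, unfolded DF Ddeg] p by simp
    have card: "int (card ?A) = q^2 + q + 1"
      using D.card_solids_above_plane[of p, unfolded DF] p by simp
    have lex: "deg l \<le> x" and nex: "\<not> (0 < deg l \<and> deg l \<le> q \<and> deg l = x)" if "l \<in> F 2" for l
      using deg_le_x[OF that] nf that by (auto simp: fl_def)
    have leq: "deg l \<le> q" if "l \<in> F 2" for l using degs[OF nf] x that by simp
    have "(\<Sum>l\<in>?A. deg l) \<le> (\<Sum>l\<in>?A. x)" by (rule sum_mono) (use lex in auto)
    then have "x + q^2 * (q + 1) \<le> (q^2 + q + 1) * x" using sum card by simp
    then have "(q * (q + 1)) * q \<le> (q * (q + 1)) * x" by (simp add: algebra_simps power2_eq_square)
    then have "q \<le> x" using q_ge by simp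
    have "(\<Sum>l\<in>?A. deg l) \<le> (\<Sum>l\<in>?A. q)" by (rule sum_mono) (use leq in auto)
    then have "x + q^2 * (q + 1) \<le> (q^2 + q + 1) * q" using sum card by simp
    then have "x \<le> q" by (simp add: algebra_simps power2_eq_square)
    with \<open>q \<le> x\<close> have "x = q" by simp
    then have "(\<Sum>l\<in>?A. deg l) \<le> (\<Sum>l\<in>?A. q - 1)"
    proof (intro sum_mono)
      fix l assume "l \<in> ?A"
      then show "deg l \<le> q - 1" using leq[of l] nex[of l] \<open>x = q\<close> q_ge by force
    qed
    then have "x + q^2 * (q + 1) \<le> (q^2 + q + 1) * (q - 1)" using sum card by simp
    moreover have "x + q^2 * (q + 1) - (q^2 + q + 1) * (q - 1) = x + q^2 + 1" by algebra
    moreover have "0 \<le> q^2" by simp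
    ultimately show False using \<open>q \<le> x\<close> q_ge by linarith
  qed
  assume x: "x = (q + 1)^2"
  show "(\<exists>S\<in>F 4. (\<forall>p\<in>F 3. p \<sqsubseteq> S \<longrightarrow> p \<in> L) \<and> (\<forall>p\<in>L. p \<sqsubseteq> S \<or> dm (p \<sqinter> S) = 1)) \<or>
      (\<exists>l\<in>F 2. (\<forall>p\<in>F 3. l \<sqsubseteq> p \<longrightarrow> p \<in> L) \<and> (\<forall>p\<in>L. l \<sqsubseteq> p \<or> dm (p \<sqinter> l) = 0)) \<or>
      (\<forall>l\<in>F 2. deg l \<in> {0, q + 1}) \<and> (\<forall>S\<in>F 4. codeg S \<in> {0, q + 1})"
  proof (cases "fl \<or> fs")
    case True
    then show ?thesis
    proof
      assume fl
      then obtain l where l: "l \<in> F 2" and all: "\<forall>p\<in>F 3. l \<sqsubseteq> p \<longrightarrow> p \<in> L"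
        unfolding fl_def by (elim bexE)
      have full: "p \<in> L" if "p \<in> F 3" "l \<sqsubseteq> p" for p using all that by simp
      have "l \<sqsubseteq> p \<or> dm (p \<sqinter> l) = 0" if "p \<in> L" for p
      proof (cases "l \<sqsubseteq> p")
        case False
        have "dm (p \<sqinter> l) = 0" by (rule full_line(2)[OF l _ x that False]) (rule full)
        then show ?thesis by (rule disjI2)
      qed simp
      then have "\<forall>p\<in>L. l \<sqsubseteq> p \<or> dm (p \<sqinter> l) = 0" by (rule ballI)
      then have "\<exists>l\<in>F 2. (\<forall>p\<in>F 3. l \<sqsubseteq> p \<longrightarrow> p \<in> L) \<and> (\<forall>p\<in>L. l \<sqsubseteq> p \<or> dm (p \<sqinter> l) = 0)"
        using all by (intro bexI[OF _ l] conjI)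
      then show ?thesis by (intro disjI2 disjI1)
    next
      assume fs
      then obtain S where S: "S \<in> F 4" "\<forall>p\<in>F 3. p \<sqsubseteq> S \<longrightarrow> p \<in> L" by (auto simp: fs_def)
      have full: "p \<in> L" if "p \<in> F 3" "p \<sqsubseteq> S" for p using S(2) that by blast
      have "dm (p \<sqinter> S) = 1" if p: "p \<in> L" "\<not> p \<sqsubseteq> S" for p
      proof -
        have p3: "p \<in> F 3" using p L_sub by auto
        have X: "p \<in> X" "S \<in> X" using F_X p3 S(1) by blast+
        \<comment> \<open>Dually to being skew, \<open>p\<close> and \<open>S\<close> span the whole
          space, and the modular law then leaves a point as their meet.\<close>
        have "6 - dm (p \<squnion> S) = 0"
          by (rule D.full_line(2)[of S p, unfolded DF, OF S(1) _ x p]) (rule full)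
        then have "dm (p \<squnion> S) = 6" using dm_le[OF jn_X[OF X]] by linarith
        then show ?thesis using modular[OF X] F_dm[OF p3] F_dm[OF S(1)] by linarith
      qed
      then have "\<exists>S\<in>F 4. (\<forall>p\<in>F 3. p \<sqsubseteq> S \<longrightarrow> p \<in> L) \<and> (\<forall>p\<in>L. p \<sqsubseteq> S \<or> dm (p \<sqinter> S) = 1)"
        using S by (intro bexI[of _ S]) blast+
      then show ?thesis by (intro disjI1)
    qed
  next
    case False
    then have nf: "\<not> fl" "\<not> fs" by simp_all
    have *: "deg l \<le> q + 1" if "l \<in> F 2" for l using degs[OF nf eq_refl[OF x]] that by blast
    have **: "codeg S \<le> q + 1" if "S \<in> F 4" for S using degs[OF nf eq_refl[OF x]] that by blast
    have "codeg S = 0 \<or> codeg S = q + 1" if "S \<in> F 4" for S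
      by (rule codeg_eq_of_le[OF x ** that])
    moreover have "deg l = 0 \<or> deg l = q + 1" if "l \<in> F 2" for l
      by (rule D.codeg_eq_of_le[unfolded DF Ddeg, OF x * that])
    ultimately have "(\<forall>l\<in>F 2. deg l \<in> {0, q + 1}) \<and> (\<forall>S\<in>F 4. codeg S \<in> {0, q + 1})" by simp
    then show ?thesis by (intro disjI2)
  qed
qed

end

section \<open>Subspaces over a finite field\<close>

text \<open>Adjoining \<open>b\<close> multiplies the size by that of the field, since a vector of
  the new span is \<open>c *s b + v\<close> for unique \<open>c\<close> and
  \<open>v\<close>.\<close>

lemma card_span_vec:
  fixes B :: "('a::{field,finite} ^ 'n) set"
  assumes "vec.independent B"
  shows "card (vec.span B) = CARD('a) ^ card B"
proof -
  have "finite B" by simp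
  then show ?thesis using assms
  proof (induction B)
    case empty
    then show ?case by simp
  next
    case (insert b B)
    then have b: "b \<notin> vec.span B" "vec.independent B" by (auto simp: vec.independent_insert)
    have "bij_betw (\<lambda>(c, v). c *s b + v) (UNIV \<times> vec.span B) (vec.span (insert b B))"
      unfolding bij_betw_def
    proof
      show "inj_on (\<lambda>(c, v). c *s b + v) (UNIV \<times> vec.span B)"
      proof (rule inj_onI, clarify)
        fix c v c' v'
        assume v: "v \<in> vec.span B" "v' \<in> vec.span B" and e: "c *s b + v = c' *s b + v'"
        have "(c - c') *s b = v' - v" using e by (simp add: vec.scale_left_diff_distrib algebra_simps)
        then have in_span: "(c - c') *s b \<in> vec.span B" using v vec.span_diff by metis
        have "c = c'"
        proof (rule ccontr)
          assume "c \<noteq> c'"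
          then have "inverse (c - c') *s ((c - c') *s b) = b"
            by (simp add: vector_smult_assoc)
          then show False using vec.span_scale[OF in_span, of "inverse (c - c')"] b by simp
        qed
        then show "c = c' \<and> v = v'" using e by simp
      qed
      show "(\<lambda>(c, v). c *s b + v) ` (UNIV \<times> vec.span B) = vec.span (insert b B)"
      proof (intro equalityI subsetI)
        fix w assume "w \<in> (\<lambda>(c, v). c *s b + v) ` (UNIV \<times> vec.span B)"
        then obtain c v where "v \<in> vec.span B" "w = c *s b + v" by auto
        then show "w \<in> vec.span (insert b B)" unfolding vec.span_insert by (auto intro!: exI[of _ c])
      next
        fix w assume "w \<in> vec.span (insert b B)"
        then obtain c where "w - c *s b \<in> vec.span B" unfolding vec.span_insert by auto
        then have "(c, w - c *s b) \<in> UNIV \<times> vec.span B" by simp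
        moreover have "w = (\<lambda>(c, v). c *s b + v) (c, w - c *s b)" by simp
        ultimately show "w \<in> (\<lambda>(c, v). c *s b + v) ` (UNIV \<times> vec.span B)" by (rule rev_image_eqI)
      qed
    qed
    then have "card (vec.span (insert b B)) = CARD('a) * card (vec.span B)"
      by (auto dest!: bij_betw_same_card simp: card_cartesian_product)
    then show ?case using insert b by simp
  qed
qed

lemma card_subspace_vec:
  fixes U :: "('a::{field,finite} ^ 'n) set"
  assumes "vec.subspace U"
  shows "card U = CARD('a) ^ vec.dim U"
proof -
  obtain B where B: "B \<subseteq> U" "vec.independent B" "U \<subseteq> vec.span B" "card B = vec.dim U"
    using vec.basis_exists by blast
  then have "vec.span B = U" using assms by (intro vec.span_subspace)
  then show ?thesis using card_span_vec[OF B(2)] B(4) by simp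
qed

text \<open>The sets \<open>C - A\<close> for the covers \<open>C\<close> partition
  \<open>B - A\<close> into blocks of equal size, because a vector outside \<open>A\<close>
  determines its cover as the span of \<open>insert v A\<close>. The quotient of sizes is a
  geometric sum.\<close>

lemma card_covers_vec:
  fixes A B :: "('a::{field,finite} ^ 'n) set"
  assumes A: "vec.subspace A" and B: "vec.subspace B" and AB: "A \<subseteq> B"
  shows "int (card {C. vec.subspace C \<and> A \<subseteq> C \<and> C \<subseteq> B \<and> vec.dim C = vec.dim A + 1}) =
    (\<Sum>i<vec.dim B - vec.dim A. int CARD('a) ^ i)"
proof -
  let ?q = "CARD('a)" and ?a = "vec.dim A" and ?b = "vec.dim B"
  let ?C = "{C. vec.subspace C \<and> A \<subseteq> C \<and> C \<subseteq> B \<and> vec.dim C = ?a + 1}"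
  have q: "?q \<ge> 2" using card_mono[of "UNIV :: 'a set" "{0, 1}"] by simp
  have ab: "?a \<le> ?b" by (rule vec.dim_subset[OF AB])
  have span_A: "vec.span A = A" using A by simp
  have cover: "vec.span (insert v A) \<in> ?C" if "v \<in> B - A" for v
  proof -
    have "v \<notin> vec.span A" using that unfolding span_A by auto
    then have "vec.dim (vec.span (insert v A)) = ?a + 1" by (simp add: vec.dim_insert)
    moreover have "vec.span (insert v A) \<subseteq> B" using that AB B by (intro vec.span_minimal) auto
    moreover have "A \<subseteq> vec.span (insert v A)" using vec.span_superset[of "insert v A"] by auto
    ultimately show ?thesis by simp
  qed
  have unique: "C = vec.span (insert v A)" if "C \<in> ?C" "v \<in> C - A" for C v
  proof (rule vec.subspace_dim_equal[symmetric])
    show "vec.span (insert v A) \<subseteq> C" using that by (intro vec.span_minimal) auto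
    have "v \<notin> vec.span A" using that unfolding span_A by auto
    then show "vec.dim C \<le> vec.dim (vec.span (insert v A))" using that by (simp add: vec.dim_insert)
  qed (use that in auto)
  have "B - A = (\<Union>C\<in>?C. C - A)"
  proof
    show "B - A \<subseteq> (\<Union>C\<in>?C. C - A)"
    proof
      fix v assume v: "v \<in> B - A"
      then have "v \<in> vec.span (insert v A) - A" using vec.span_base[of v "insert v A"] by auto
      then show "v \<in> (\<Union>C\<in>?C. C - A)" using cover[OF v] by blast
    qed
  qed auto
  then have "card (B - A) = card (\<Union>C\<in>?C. C - A)" by simp
  also have "\<dots> = (\<Sum>C\<in>?C. card (C - A))"
  proof (rule card_UN_disjoint)
    show "\<forall>C\<in>?C. \<forall>C'\<in>?C. C \<noteq> C' \<longrightarrow> (C - A) \<inter> (C' - A) = {}"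
    proof (intro ballI impI, rule ccontr)
      fix C C' assume C: "C \<in> ?C" "C' \<in> ?C" "C \<noteq> C'" "(C - A) \<inter> (C' - A) \<noteq> {}"
      then obtain v where "v \<in> C - A" "v \<in> C' - A" by auto
      then show False using unique[OF C(1)] unique[OF C(2)] C(3) by metis
    qed
  qed auto
  also have "\<dots> = (\<Sum>C\<in>?C. ?q ^ (?a + 1) - ?q ^ ?a)"
  proof (rule sum.cong[OF refl])
    fix C assume "C \<in> ?C"
    then show "card (C - A) = ?q ^ (?a + 1) - ?q ^ ?a"
      using A card_subspace_vec[of C] card_subspace_vec[OF A] by (subst card_Diff_subset) auto
  qed
  finally have "card (B - A) = card ?C * (?q ^ (?a + 1) - ?q ^ ?a)" by simp
  moreover have "card (B - A) = ?q ^ ?b - ?q ^ ?a"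
    using AB card_subspace_vec[OF A] card_subspace_vec[OF B] by (subst card_Diff_subset) auto
  ultimately have "int (?q ^ ?b - ?q ^ ?a) = int (card ?C * (?q ^ (?a + 1) - ?q ^ ?a))" by simp
  moreover have "?q ^ ?a \<le> ?q ^ ?b" "?q ^ ?a \<le> ?q ^ (?a + 1)"
    using q ab by (intro power_increasing; simp)+
  ultimately have "int ?q ^ ?b - int ?q ^ ?a = int (card ?C) * (int ?q ^ (?a + 1) - int ?q ^ ?a)"
    by (simp add: of_nat_diff)
  moreover have "int ?q ^ ?b = int ?q ^ ?a * int ?q ^ (?b - ?a)"
    using ab by (simp flip: power_add)
  ultimately have "int ?q ^ ?a * (int ?q ^ (?b - ?a) - 1) =
      int ?q ^ ?a * ((int ?q - 1) * int (card ?C))"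
    by (simp add: algebra_simps)
  then have "int ?q ^ (?b - ?a) - 1 = (int ?q - 1) * int (card ?C)"
    using q by simp
  then have "(int ?q - 1) * (\<Sum>i<?b - ?a. int ?q ^ i) = (int ?q - 1) * int (card ?C)"
    by (simp add: power_diff_1_eq)
  then show ?thesis using q by simp
qed

lemma subspace_lattice_vec:
  assumes "CARD('a::{field,finite}) \<ge> 9"
  shows "subspace_lattice (int CARD('a)) {U :: ('a ^ 6) set. vec.subspace U} (\<subseteq>) vec.dim (\<inter>)
    (\<lambda>U W. vec.span (U \<union> W))"
proof
  fix U W :: "('a ^ 6) set"
  assume "U \<in> {U. vec.subspace U}" "W \<in> {U. vec.subspace U}"
  then have UW: "vec.subspace U" "vec.subspace W" by auto
  then have span: "vec.span U = U" "vec.span W = W" by simp_all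
  have "vec.span (U \<union> W) = {x + y |x y. x \<in> U \<and> y \<in> W}"
    by (simp only: vec.span_Un span)
  then show "vec.dim (U \<inter> W) + vec.dim (vec.span (U \<union> W)) = vec.dim U + vec.dim W"
    using vec.dim_sums_Int[OF UW] by simp
next
  show "\<exists>t\<in>{U :: ('a ^ 6) set. vec.subspace U}. vec.dim t = 6 \<and> (\<forall>a\<in>{U. vec.subspace U}. a \<subseteq> t)"
    by (rule bexI[of _ UNIV]) (auto simp: vec.dim_UNIV vec.dimension_def card_cart_basis)
next
  show "\<exists>z\<in>{U :: ('a ^ 6) set. vec.subspace U}. vec.dim z = 0 \<and> (\<forall>a\<in>{U. vec.subspace U}. z \<subseteq> a)"
    by (rule bexI[of _ "{0}"]) (auto simp: vec.subspace_0)
next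
  fix U :: "('a ^ 6) set"
  show "vec.dim U \<le> 6" using vec.dim_subset_UNIV[of U] by (simp add: vec.dimension_def card_cart_basis)
next
  fix U W :: "('a ^ 6) set"
  assume "U \<in> {U. vec.subspace U}" "W \<in> {U. vec.subspace U}" "U \<subseteq> W" "vec.dim U = vec.dim W"
  then show "U = W" using vec.subspace_dim_equal[of U W] by simp
next
  fix U W :: "('a ^ 6) set"
  assume "U \<in> {U. vec.subspace U}" "W \<in> {U. vec.subspace U}" "U \<subseteq> W"
  then show "int (card {C \<in> {U. vec.subspace U}. U \<subseteq> C \<and> C \<subseteq> W \<and> vec.dim C = vec.dim U + 1}) =
      (\<Sum>i<vec.dim W - vec.dim U. int CARD('a) ^ i)"
    using card_covers_vec[of U W] by simp
next
  fix U V W :: "('a ^ 6) set"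
  assume "W \<in> {U. vec.subspace U}" "U \<subseteq> W" "V \<subseteq> W"
  then show "vec.span (U \<union> V) \<subseteq> W" by (intro vec.span_minimal) auto
qed (use assms in \<open>auto intro: vec.subspace_inter vec.dim_subset vec.span_base\<close>)

text \<open>Reads \<open>regular_planes_bound\<close> in the subspaces of the 6-dimensional
  coordinate space, where vector dimensions 0, 1 and 2 of a meet stand for skew, a point and a
  line.\<close>

theorem theorem4p1:
  fixes q :: nat
    and x :: int
    and L :: "('a::{field,finite} ^ 6) set set"
  assumes "primepow q"
    and "q \<ge> 25"
    and "CARD('a) = q"
    and "L \<subseteq> {\<pi>. is_plane \<pi>}"
    and "L \<noteq> {}"
    and "L \<noteq> {\<pi>. is_plane \<pi>}"
    and "x > 0"
    and "int (card L) = x * (int q ^ 2 + 1) * (int q ^ 2 - int q + 1)"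
    and "\<And>\<pi>. \<pi> \<in> L \<Longrightarrow>
           int (card {\<sigma> \<in> L. \<sigma> \<noteq> \<pi> \<and> is_line (\<pi> \<inter> \<sigma>)}) = lambda2 q + x"
    and "\<And>\<pi>. is_plane \<pi> \<Longrightarrow> \<pi> \<notin> L \<Longrightarrow>
           int (card {\<sigma> \<in> L. is_line (\<pi> \<inter> \<sigma>)}) = x"
  shows "x \<ge> (int q + 1) ^ 2 \<and>
    (x = (int q + 1) ^ 2 \<longrightarrow>
      ((\<exists>S. is_solid S \<and>
            (\<forall>\<pi>. is_plane \<pi> \<and> \<pi> \<subseteq> S \<longrightarrow> \<pi> \<in> L) \<and>
            (\<forall>\<pi>\<in>L. \<pi> \<subseteq> S \<or> is_point (\<pi> \<inter> S)))
       \<or> (\<exists>l. is_line l \<and>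
            (\<forall>\<pi>. is_plane \<pi> \<and> l \<subseteq> \<pi> \<longrightarrow> \<pi> \<in> L) \<and>
            (\<forall>\<pi>\<in>L. l \<subseteq> \<pi> \<or> skew \<pi> l)))
      \<or> ((\<forall>l. is_line l \<longrightarrow> card {\<pi> \<in> L. l \<subseteq> \<pi>} \<in> {0, q + 1}) \<and>
         (\<forall>S. is_solid S \<longrightarrow> card {\<pi> \<in> L. \<pi> \<subseteq> S} \<in> {0, q + 1})))"
proof -
  interpret R: subspace_lattice "int q" "{U :: ('a ^ 6) set. vec.subspace U}" "(\<subseteq>)" vec.dim "(\<inter>)"
    "\<lambda>U W. vec.span (U \<union> W)"
    using subspace_lattice_vec[where 'a = 'a] assms(2,3) by simp
  have F: "R.F 2 = {l. is_line l}" "R.F 3 = {p. is_plane p}" "R.F 4 = {S. is_solid S}"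
    by (auto simp: R.F_def proj_subspace_def)
  interpret R: regular_planes "int q" "{U :: ('a ^ 6) set. vec.subspace U}" "(\<subseteq>)" vec.dim "(\<inter>)"
    "\<lambda>U W. vec.span (U \<union> W)" L x
  proof
    show "L \<subseteq> R.F 3" using assms(4) F by simp
    show "int (card L) = x * ((int q)^2 + 1) * ((int q)^2 - int q + 1)" using assms(8) by simp
    fix p assume "p \<in> R.F 3"
    then have p: "is_plane p" using F by simp
    have line: "is_line (p \<inter> s) \<longleftrightarrow> vec.dim (p \<inter> s) = 2" if "s \<in> L" for s
    proof -
      have "vec.subspace (p \<inter> s)"
        using p that assms(4) by (intro vec.subspace_inter) (auto simp: proj_subspace_def)
      then show ?thesis by (simp add: proj_subspace_def numeral_2_eq_2)
    qed
    show "int (card {s\<in>L. s \<noteq> p \<and> vec.dim (p \<inter> s) = 2}) =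
        x + (if p \<in> L then int q ^ 3 - int q - 1 else 0)"
    proof (cases "p \<in> L")
      case True
      have "{s\<in>L. s \<noteq> p \<and> vec.dim (p \<inter> s) = 2} = {s\<in>L. s \<noteq> p \<and> is_line (p \<inter> s)}"
        using line by blast
      then show ?thesis using assms(9)[OF True] True by (simp add: lambda2_def)
    next
      case False
      then have "{s\<in>L. s \<noteq> p \<and> vec.dim (p \<inter> s) = 2} = {s\<in>L. is_line (p \<inter> s)}"
        using line by blast
      then show ?thesis using assms(10)[OF p False] False by simp
    qed
  qed
  have sub: "vec.subspace p" if "p \<in> L" for p using that assms(4) by (auto simp: proj_subspace_def)
  have point: "is_point (p \<inter> S)" if "p \<in> L" "is_solid S" "vec.dim (p \<inter> S) = 1" for p S
    using that sub[of p] vec.subspace_inter[of p S] by (simp add: proj_subspace_def)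
  have skew: "skew p l" if "p \<in> L" "is_line l" "vec.dim (p \<inter> l) = 0" for p l
    using that sub[of p] vec.subspace_inter[of p l] vec.subspace_0[of "p \<inter> l"]
    by (auto simp: proj_subspace_def skew_def)
  have "int q + 1 = int (q + 1)" by simp
  then have deg: "R.deg l \<in> {0, int q + 1} \<longleftrightarrow> card {p\<in>L. l \<subseteq> p} \<in> {0, q + 1}"
    and codeg: "R.codeg S \<in> {0, int q + 1} \<longleftrightarrow> card {p\<in>L. p \<subseteq> S} \<in> {0, q + 1}" for l S
    unfolding R.deg_def R.codeg_def by (simp_all only: insert_iff empty_iff of_nat_eq_iff of_nat_eq_0_iff)
  show ?thesis
  proof (intro conjI impI)
    show "(int q + 1)^2 \<le> x" by (rule R.regular_planes_bound(1)[OF assms(5)])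
    assume "x = (int q + 1)^2"
    from R.regular_planes_bound(2)[OF assms(5) this, unfolded F deg codeg]
    show "((\<exists>S. is_solid S \<and>
            (\<forall>\<pi>. is_plane \<pi> \<and> \<pi> \<subseteq> S \<longrightarrow> \<pi> \<in> L) \<and>
            (\<forall>\<pi>\<in>L. \<pi> \<subseteq> S \<or> is_point (\<pi> \<inter> S)))
       \<or> (\<exists>l. is_line l \<and>
            (\<forall>\<pi>. is_plane \<pi> \<and> l \<subseteq> \<pi> \<longrightarrow> \<pi> \<in> L) \<and>
            (\<forall>\<pi>\<in>L. l \<subseteq> \<pi> \<or> skew \<pi> l)))
      \<or> ((\<forall>l. is_line l \<longrightarrow> card {\<pi> \<in> L. l \<subseteq> \<pi>} \<in> {0, q + 1}) \<and>
         (\<forall>S. is_solid S \<longrightarrow> card {\<pi> \<in> L. \<pi> \<subseteq> S} \<in> {0, q + 1}))"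
    proof (elim disjE bexE conjE)
      fix S
      assume S: "S \<in> {S. is_solid S}" "\<forall>p\<in>{p. is_plane p}. p \<subseteq> S \<longrightarrow> p \<in> L"
        and meet: "\<forall>p\<in>L. p \<subseteq> S \<or> vec.dim (p \<inter> S) = 1"
      have "\<forall>p\<in>L. p \<subseteq> S \<or> is_point (p \<inter> S)"
      proof
        fix p assume p: "p \<in> L"
        then show "p \<subseteq> S \<or> is_point (p \<inter> S)" using bspec[OF meet p] point[OF p, of S] S(1) by auto
      qed
      with S show ?thesis by (intro disjI1 exI[of _ S]) simp
    next
      fix l
      assume l: "l \<in> {l. is_line l}" "\<forall>p\<in>{p. is_plane p}. l \<subseteq> p \<longrightarrow> p \<in> L"
        and meet: "\<forall>p\<in>L. l \<subseteq> p \<or> vec.dim (p \<inter> l) = 0"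
      have "\<forall>p\<in>L. l \<subseteq> p \<or> skew p l"
      proof
        fix p assume p: "p \<in> L"
        then show "l \<subseteq> p \<or> skew p l" using bspec[OF meet p] skew[OF p, of l] l(1) by auto
      qed
      with l show ?thesis by (intro disjI1 disjI2 exI[of _ l]) simp
    qed simp
  qed
qed

end
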